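(* Suppose Assumption A (see context) holds. Let $D_g$ be a fixed diameter bound, $D_g\ge\operatorname{diam}(\operatorname{dom}(g_2))$, let $B_f\ge1$ be a Lipschitz constant for $f$ on $\operatorname{dom}(g_2)$, and let $Q_{\rm init}$ be as in the context. Let the inputs satisfy $D_g>0$, $0<\delta_{\rm init}\le1/B_f$ and $x^f_{\rm init},x^g_{\rm init}\in\operatorname{dom}(g_2)$. Then the routine LBInit$(\delta_{\rm init},D_g,B_f,x^f_{\rm init},x^g_{\rm init})$ of the context terminates and returns a tuple $(l_0,\Delta,x_f,M_\Delta)$ that is a reference certificate (as defined in the context), and $$M_\Delta\le\Omega_gQ_{\rm init},\qquad \Delta\ge Q_{\rm init}^{-1}.$$ Moreover, the total number of basic operations is bounded by $$T_{\rm pre}:=\mathcal O\!\left(\left[\sqrt{C_DL_{f_1}\Omega_g}\,Q_{\rm init}+\sqrt{C_DL_{g_1}}\sqrt{Q_{\rm init}}\right](1+\log Q_{\rm init})^2\right).$$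
   Context: **Problem.** $f=f_1+f_2$, $g=g_1+g_2$ on $\mathbb R^n$; $f_1,g_1:\mathbb R^n\to\mathbb R$ are convex and continuously differentiable with gradients Lipschitz with constants $L_{f_1}>0$, $L_{g_1}\ge1$; $f_2,g_2:\mathbb R^n\to\mathbb R\cup\{+\infty\}$ are proper, l.s.c., convex. (SBO) is: $\min_x f(x)$ s.t. $x\in\arg\min_{z\in\mathbb R^n}g(z)$. The lower-level and SBO solution sets are assumed nonempty. $g^*=\min_{\operatorname{dom}(g_2)}g$, $f^*=\min_{\operatorname{dom}(g_2)}f$, and $p^*$ is the optimal value of (SBO). **Assumption A.** (i) The restriction of $g_2$ to $\operatorname{dom}(g_2)$ is continuous; $\operatorname{dom}(g_2)$ is nonempty, compact, convex; $\operatorname{dom}(g_2)\subseteq\operatorname{dom}(f_2)$; $f_2$ is $l_{f_2}$-Lipschitz on $\operatorname{dom}(g_2)$. (ii) $p^*>f^*$. **Constants.** $\Omega_g=\sup_{x\in\operatorname{dom}(g_2)}\{g(x)-g^*+1\}<\infty$, $C_D=1+D_g(1+D_g)$, $\bar g(c)=\min\{g(x): f(x)\le c\}$, $m_0=\bar g((p^*+f^* )/2)-g^*>0$, $Q_{\rm init}=\max\{1/\delta_{\rm init},\,8/(p^*-f^* ),\,8/m_0\}$. $[a]_+=\max\{a,0\}$. **Reference certificate.** A tuple $(l_0,\Delta,x_f,M_\Delta)$ such that $x_f\in\operatorname{dom}(g_2)$, $f^*<l_0<p^*$, $l_0=f(x_f)+\Delta$, $\Delta>0$, and there exists $x_g^{\rm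 ref}\in\operatorname{dom}(g_2)$ with $g(x_g^{\rm ref})-g^*\le1$ and $M_\Delta=\max\{(g(x_f)-g(x_g^{\rm ref})+1)/\Delta,\,1\}$ (which is automatically $\le\max\{\Omega_g/\Delta,1\}$). **Operations and $\mathcal O$.** A basic operation is one evaluation of $f_1,f_2,g_1,g_2,\nabla f_1,\nabla g_1$, $\operatorname{prox}_{\tau(g_2+\theta f_2)}$ or $\operatorname{prox}_{\tau(f_2+I_{\operatorname{dom}(g_2)})}$ ($\tau>0$, $\theta\ge0$; $I_C$ is the indicator function of $C$, equal to $0$ on $C$ and $+\infty$ elsewhere). Constants hidden in $\mathcal O$ may depend (through logarithmic factors) on $D_g,\Omega_g,L_{f_1},L_{g_1}$, but not on $\delta_{\rm init}$, $p^*-f^*$ or $m_0$. **Black-box APG subroutines** (for $\varphi=\varphi_1+\varphi_2$, $\varphi_1$ convex differentiable with $L_{\varphi_1}$-Lipschitz gradient, $L_{\varphi_1}>0$, $\varphi_2$ proper l.s.c. convex with computable prox; a proximal-gradient operation uses a bounded number of basic operations). ${\rm APG}_0(\varphi_1,\varphi_2,\delta,x_{\rm init},D)$, with $\delta>0$ and $D\ge\operatorname{dist}(x_{\rm init},\arg\min\varphi)$, returns $\tilde x\in\operatorname{dom}(\varphi_2)$ with $\varphi(\tilde x)-\min\varphi\le\delta$ within $\mathcal O(D\sqrt{L_{\varphi_1}/\delta})$ proximal-gradient operations. ${\rm APG}_\mu(\varphi_1,\varphi_2,\delta,x_{\rm init})$, where $\varphi_1$ is $\mu$-strongly convex with $\mu>0$,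 $\operatorname{diam}(\operatorname{dom}\varphi_2)\le D$ and $x_{\rm init}\in\operatorname{dom}(\varphi_2)$, returns $\tilde x\in\operatorname{dom}(\varphi_2)$ with $\operatorname{dist}(0,\partial\varphi(\tilde x))\le\delta$ using $\mathcal O(\sqrt{L_{\varphi_1}/\mu}\,(1+\lceil\log_2(L_{\varphi_1}D/\delta)\rceil_+))$ proximal-gradient operations ($\lceil a\rceil_+$ is the smallest nonnegative integer $\ge a$). **Routine Dual$(\phi,\psi,\sigma,M,x_{\rm init};\delta)$**, $\phi=\phi_1+\phi_2$ with $\phi_1$ $\mu_{\phi_1}$-strongly convex, $\psi=\psi_1+\psi_2$. Set $\varepsilon_1=\mu_{\phi_1}\delta^2$, $\varepsilon_2=\delta$, $\varepsilon_3=4M\delta$ and $A(z)={\rm APG}_\mu(\phi_1+z\psi_1,\phi_2+z\psi_2,\varepsilon_1,x_{\rm init})$. *Interval search*: $\tilde x=A(0)$; if $[\psi(\tilde x)]_+\le\varepsilon_2$ return $(\tilde x,0)$. Else $a=0$, $b=\sigma$, $\tilde x_a=\tilde x$, $\tilde x_b=A(b)$; while $[\psi(\tilde x_b)]_+>\varepsilon_2$ and $b<M$: $a\gets b$, $b\gets2b$, $\tilde x_a\gets\tilde x_b$, $\tilde x_b\gets A(b)$. If $|b\psi(\tilde x_b)|\le\varepsilon_3$ return $(\tilde x_b,b)$. *Bisection*: otherwise, while $b-a>\mu_{\phi_1}\delta^3$: $z=(a+b)/2$, $x=A(z)$; if $[\psi(x)]_+>\varepsilon_2$ set $a\gets z,\tilde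 x_a\gets x$; else if $|z\psi(x)|\le\varepsilon_3$ return $(x,z)$; else $b\gets z,\tilde x_b\gets x$. On loop exit return $(\tilde x_b,b)$. **Routine LBInit$(\delta_{\rm init},D_g,B_f,x^f_{\rm init},x^g_{\rm init})$.** Start with $\Delta\gets2\delta_{\rm init}$, $x_f\gets x^f_{\rm init}$, $x_g^{\rm ref}\gets x^g_{\rm init}$, $\tilde x\gets x^f_{\rm init}$. For $k=0,1,\dots$: $\Delta\gets\Delta/2$; $x_f\gets{\rm APG}_0(f_1,f_2+I_{\operatorname{dom}(g_2)},\Delta,x_f,D_g)$; $x_g^{\rm ref}\gets{\rm APG}_0(g_1,g_2,\Delta,x_g^{\rm ref},D_g)$; $l\gets f(x_f)+\Delta$; $M_\Delta\gets\max\{(g(x_f)-g(x_g^{\rm ref})+1)/\Delta,1\}$; $C_\Delta\gets4C_DM_\Delta$; $\eta\gets\Delta/C_D$; $(\tilde x,\cdot)\gets$ Dual$(G_\eta,f-l,1,M_\Delta,\tilde x;\Delta/C_\Delta)$, where $G_\eta=g+\frac\eta2\|\cdot-x_f\|^2$ and Dual uses $\phi_1=g_1+\frac\eta2\|\cdot-x_f\|^2$, $\phi_2=g_2$, $\psi_1=f_1-l$, $\psi_2=f_2$, $\mu_{\phi_1}=\eta$; if $g(\tilde x)-g(x_g^{\rm ref})>\Delta$ return $(l,\Delta,x_f,M_\Delta)$ (so $l_0:=l$). *)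

theory Defs
  imports "HOL-Analysis.Analysis" "HOL-Library.Monad_Syntax"
begin

section \<open>Convex analysis for extended-valued functions\<close>

definition edom :: "('a \<Rightarrow> ereal) \<Rightarrow> 'a set" where
  "edom h = {x. h x < \<infinity>}"

definition proper :: "('a \<Rightarrow> ereal) \<Rightarrow> bool" where
  "proper h \<longleftrightarrow> (\<forall>x. h x \<noteq> -\<infinity>) \<and> edom h \<noteq> {}"

definition lsc :: "('a::topological_space \<Rightarrow> ereal) \<Rightarrow> bool" where
  "lsc h \<longleftrightarrow> (\<forall>x. h x \<le> Liminf (at x) h)"

text \<open>In \<^typ>\<open>ereal\<close>, zero times infinity is zero, so the end points \<open>t = 0\<close> and \<open>t = 1\<close> are harmless.\<close>

definition econvex :: "('a::real_vector \<Rightarrow> ereal) \<Rightarrow> bool" where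
  "econvex h \<longleftrightarrow> (\<forall>x y. \<forall>t\<in>{0..1}.
     h ((1 - t) *\<^sub>R x + t *\<^sub>R y) \<le> ereal (1 - t) * h x + ereal t * h y)"

definition strongly_convex :: "real \<Rightarrow> ('a::real_inner \<Rightarrow> real) \<Rightarrow> bool" where
  "strongly_convex \<mu> h \<longleftrightarrow> (\<forall>x y. \<forall>t\<in>{0..1}.
     h ((1 - t) *\<^sub>R x + t *\<^sub>R y)
       \<le> (1 - t) * h x + t * h y - \<mu> / 2 * t * (1 - t) * (norm (x - y))\<^sup>2)"

definition lipschitz_gradient :: "real \<Rightarrow> ('a::real_inner \<Rightarrow> real) \<Rightarrow> bool" where
  "lipschitz_gradient L h \<longleftrightarrow> (\<exists>G. (\<forall>x. GDERIV h x :> G x) \<and> L-lipschitz_on UNIV G)"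

definition indic :: "'a set \<Rightarrow> 'a \<Rightarrow> ereal" where
  "indic C x = (if x \<in> C then 0 else \<infinity>)"

definition esum :: "('a \<Rightarrow> real) \<Rightarrow> ('a \<Rightarrow> ereal) \<Rightarrow> 'a \<Rightarrow> ereal" where
  "esum h1 h2 x = ereal (h1 x) + h2 x"

definition argmin :: "('a \<Rightarrow> ereal) \<Rightarrow> 'a set" where
  "argmin h = {x. is_arg_min h (\<lambda>_. True) x}"

definition subdiff :: "('a::real_inner \<Rightarrow> ereal) \<Rightarrow> 'a \<Rightarrow> 'a set" where
  "subdiff h x = {v. \<forall>y. h x + ereal (v \<bullet> (y - x)) \<le> h y}"

text \<open>The real value of a minimum, meant for minima that are finite; \<^const>\<open>real_of_ereal\<close> sends
  infinite values to 0.\<close>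

definition min_val :: "('a \<Rightarrow> ereal) \<Rightarrow> 'a set \<Rightarrow> real" where
  "min_val h S = real_of_ereal (INF x\<in>S. h x)"


section \<open>Simple bilevel optimization\<close>

definition sbo_problem ::
  "('a::euclidean_space \<Rightarrow> real) \<Rightarrow> ('a \<Rightarrow> ereal) \<Rightarrow> ('a \<Rightarrow> real) \<Rightarrow> ('a \<Rightarrow> ereal) \<Rightarrow> real \<Rightarrow> real \<Rightarrow> bool" where
  "sbo_problem f1 f2 g1 g2 Lf Lg \<longleftrightarrow>
     convex_on UNIV f1 \<and> lipschitz_gradient Lf f1 \<and> Lf > 0 \<and>
     convex_on UNIV g1 \<and> lipschitz_gradient Lg g1 \<and> Lg \<ge> 1 \<and>
     proper f2 \<and> lsc f2 \<and> econvex f2 \<and>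
     proper g2 \<and> lsc g2 \<and> econvex g2 \<and>
     argmin (esum g1 g2) \<noteq> {} \<and>
     {x. is_arg_min (esum f1 f2) (\<lambda>x. x \<in> argmin (esum g1 g2)) x} \<noteq> {}"

definition g_star :: "('a \<Rightarrow> real) \<Rightarrow> ('a \<Rightarrow> ereal) \<Rightarrow> real" where
  "g_star g1 g2 = min_val (esum g1 g2) (edom g2)"

definition f_star :: "('a \<Rightarrow> real) \<Rightarrow> ('a \<Rightarrow> ereal) \<Rightarrow> ('a \<Rightarrow> ereal) \<Rightarrow> real" where
  "f_star f1 f2 g2 = min_val (esum f1 f2) (edom g2)"

definition p_star ::
  "('a \<Rightarrow> real) \<Rightarrow> ('a \<Rightarrow> ereal) \<Rightarrow> ('a \<Rightarrow> real) \<Rightarrow> ('a \<Rightarrow> ereal) \<Rightarrow> real" where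
  "p_star f1 f2 g1 g2 = min_val (esum f1 f2) (argmin (esum g1 g2))"

definition g_bar ::
  "('a \<Rightarrow> real) \<Rightarrow> ('a \<Rightarrow> ereal) \<Rightarrow> ('a \<Rightarrow> real) \<Rightarrow> ('a \<Rightarrow> ereal) \<Rightarrow> real \<Rightarrow> real" where
  "g_bar f1 f2 g1 g2 c = min_val (esum g1 g2) {x. esum f1 f2 x \<le> ereal c}"

definition assumption_A ::
  "('a::euclidean_space \<Rightarrow> real) \<Rightarrow> ('a \<Rightarrow> ereal) \<Rightarrow> ('a \<Rightarrow> real) \<Rightarrow> ('a \<Rightarrow> ereal) \<Rightarrow> bool" where
  "assumption_A f1 f2 g1 g2 \<longleftrightarrow>
     continuous_on (edom g2) g2 \<and>
     edom g2 \<noteq> {} \<and> compact (edom g2) \<and> convex (edom g2) \<and>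
     edom g2 \<subseteq> edom f2 \<and>
     (\<exists>l. l-lipschitz_on (edom g2) (\<lambda>x. real_of_ereal (f2 x))) \<and>
     p_star f1 f2 g1 g2 > f_star f1 f2 g2"

definition Omega_g :: "('a \<Rightarrow> real) \<Rightarrow> ('a \<Rightarrow> ereal) \<Rightarrow> real" where
  "Omega_g g1 g2 = (SUP x\<in>edom g2. real_of_ereal (esum g1 g2 x) - g_star g1 g2 + 1)"

definition C_D :: "real \<Rightarrow> real" where
  "C_D D = 1 + D * (1 + D)"

definition m0 ::
  "('a \<Rightarrow> real) \<Rightarrow> ('a \<Rightarrow> ereal) \<Rightarrow> ('a \<Rightarrow> real) \<Rightarrow> ('a \<Rightarrow> ereal) \<Rightarrow> real" where
  "m0 f1 f2 g1 g2 =
     g_bar f1 f2 g1 g2 ((p_star f1 f2 g1 g2 + f_star f1 f2 g2) / 2) - g_star g1 g2"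

definition Q_init ::
  "('a \<Rightarrow> real) \<Rightarrow> ('a \<Rightarrow> ereal) \<Rightarrow> ('a \<Rightarrow> real) \<Rightarrow> ('a \<Rightarrow> ereal) \<Rightarrow> real \<Rightarrow> real" where
  "Q_init f1 f2 g1 g2 d_init =
     Max {1 / d_init, 8 / (p_star f1 f2 g1 g2 - f_star f1 f2 g2), 8 / m0 f1 f2 g1 g2}"

definition reference_certificate ::
  "('a \<Rightarrow> real) \<Rightarrow> ('a \<Rightarrow> ereal) \<Rightarrow> ('a \<Rightarrow> real) \<Rightarrow> ('a \<Rightarrow> ereal) \<Rightarrow>
   real \<times> real \<times> 'a \<times> real \<Rightarrow> bool" where
  "reference_certificate f1 f2 g1 g2 = (\<lambda>(l0, \<Delta>, xf, M).
     xf \<in> edom g2 \<and> f_star f1 f2 g2 < l0 \<and> l0 < p_star f1 f2 g1 g2 \<and>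
     ereal l0 = esum f1 f2 xf + ereal \<Delta> \<and> \<Delta> > 0 \<and>
     (\<exists>xg\<in>edom g2. real_of_ereal (esum g1 g2 xg) - g_star g1 g2 \<le> 1 \<and>
        M = max ((real_of_ereal (esum g1 g2 xf) - real_of_ereal (esum g1 g2 xg) + 1) / \<Delta>) 1))"


section \<open>Black-box subroutines\<close>

text \<open>A subroutine is a function returning the computed point together with the number of basic
  operations used. A proximal-gradient operation on \<open>\<phi>\<^sub>1 + \<phi>\<^sub>2\<close> can be carried out with boundedly many
  basic operations when \<open>\<phi>\<^sub>1\<close> is, up to a quadratic, a combination of \<open>f\<^sub>1\<close> and \<open>g\<^sub>1\<close>, and
  \<open>\<phi>\<^sub>2\<close> is \<open>g\<^sub>2 + \<theta> f\<^sub>2\<close> or \<open>f\<^sub>2\<close> plus the indicator of the domain of \<open>g\<^sub>2\<close>.\<close>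

definition computable_smooth ::
  "('a::real_inner \<Rightarrow> real) \<Rightarrow> ('a \<Rightarrow> real) \<Rightarrow> ('a \<Rightarrow> real) \<Rightarrow> bool" where
  "computable_smooth f1 g1 \<phi>1 \<longleftrightarrow> (\<exists>\<alpha>\<ge>0. \<exists>\<beta>\<ge>0. \<exists>\<gamma>\<ge>0. \<exists>c d.
     \<phi>1 = (\<lambda>x. \<alpha> * f1 x + \<beta> * g1 x + \<gamma> / 2 * (norm (x - c))\<^sup>2 + d))"

definition computable_prox ::
  "('a \<Rightarrow> ereal) \<Rightarrow> ('a \<Rightarrow> ereal) \<Rightarrow> ('a \<Rightarrow> ereal) \<Rightarrow> bool" where
  "computable_prox f2 g2 \<phi>2 \<longleftrightarrow>
     (\<exists>\<theta>\<ge>0. \<phi>2 = (\<lambda>x. g2 x + ereal \<theta> * f2 x)) \<or> \<phi>2 = (\<lambda>x. f2 x + indic (edom g2) x)"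

definition composite_problem ::
  "('a::euclidean_space \<Rightarrow> real) \<Rightarrow> ('a \<Rightarrow> ereal) \<Rightarrow> ('a \<Rightarrow> real) \<Rightarrow> ('a \<Rightarrow> ereal) \<Rightarrow>
   ('a \<Rightarrow> real) \<Rightarrow> ('a \<Rightarrow> ereal) \<Rightarrow> real \<Rightarrow> bool" where
  "composite_problem f1 f2 g1 g2 \<phi>1 \<phi>2 L \<longleftrightarrow>
     computable_smooth f1 g1 \<phi>1 \<and> computable_prox f2 g2 \<phi>2 \<and>
     convex_on UNIV \<phi>1 \<and> lipschitz_gradient L \<phi>1 \<and> L > 0 \<and>
     proper \<phi>2 \<and> lsc \<phi>2 \<and> econvex \<phi>2"

text \<open>Arguments of \<open>APG\<^sub>0\<close>: \<open>\<phi>\<^sub>1 \<phi>\<^sub>2 L \<delta> x D\<close>; the Lipschitz constant \<open>L\<close> is passed because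
  the method may use it as a step size. The summand 1 in the bound accounts for calls where
  \<open>D * sqrt (L / \<delta>) < 1\<close>, for which an output still has to be computed.\<close>

type_synonym 'a apg0 =
  "('a \<Rightarrow> real) \<Rightarrow> ('a \<Rightarrow> ereal) \<Rightarrow> real \<Rightarrow> real \<Rightarrow> 'a \<Rightarrow> real \<Rightarrow> 'a \<times> nat"

definition apg0_spec ::
  "real \<Rightarrow> nat \<Rightarrow> ('a::euclidean_space \<Rightarrow> real) \<Rightarrow> ('a \<Rightarrow> ereal) \<Rightarrow> ('a \<Rightarrow> real) \<Rightarrow> ('a \<Rightarrow> ereal) \<Rightarrow>
   'a apg0 \<Rightarrow> bool" where
  "apg0_spec K \<kappa> f1 f2 g1 g2 apg0 \<longleftrightarrow> (\<forall>\<phi>1 \<phi>2 L \<delta> x D y ops.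
     composite_problem f1 f2 g1 g2 \<phi>1 \<phi>2 L \<longrightarrow> \<delta> > 0 \<longrightarrow>
     argmin (esum \<phi>1 \<phi>2) \<noteq> {} \<longrightarrow> infdist x (argmin (esum \<phi>1 \<phi>2)) \<le> D \<longrightarrow>
     apg0 \<phi>1 \<phi>2 L \<delta> x D = (y, ops) \<longrightarrow>
       y \<in> edom \<phi>2 \<and> esum \<phi>1 \<phi>2 y \<le> (INF z. esum \<phi>1 \<phi>2 z) + ereal \<delta> \<and>
       (\<exists>pg_ops. real pg_ops \<le> K * (1 + D * sqrt (L / \<delta>)) \<and> ops \<le> \<kappa> * pg_ops))"

text \<open>Arguments of \<open>APG\<^sub>\<mu>\<close>: \<open>\<mu> \<phi>\<^sub>1 \<phi>\<^sub>2 L \<delta> x\<close>. Since \<^const>\<open>infdist\<close> to the empty set is 0, whereas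
  the distance to it should be infinite, nonemptiness of the subdifferential is required
  separately. Similarly, \<^const>\<open>diameter\<close> is only meaningful for bounded sets.\<close>

type_synonym 'a apgmu =
  "real \<Rightarrow> ('a \<Rightarrow> real) \<Rightarrow> ('a \<Rightarrow> ereal) \<Rightarrow> real \<Rightarrow> real \<Rightarrow> 'a \<Rightarrow> 'a \<times> nat"

definition apgmu_spec ::
  "real \<Rightarrow> nat \<Rightarrow> ('a::euclidean_space \<Rightarrow> real) \<Rightarrow> ('a \<Rightarrow> ereal) \<Rightarrow> ('a \<Rightarrow> real) \<Rightarrow> ('a \<Rightarrow> ereal) \<Rightarrow>
   'a apgmu \<Rightarrow> bool" where
  "apgmu_spec K \<kappa> f1 f2 g1 g2 apgmu \<longleftrightarrow> (\<forall>\<mu> \<phi>1 \<phi>2 L \<delta> x D y ops.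
     composite_problem f1 f2 g1 g2 \<phi>1 \<phi>2 L \<longrightarrow> \<mu> > 0 \<longrightarrow> strongly_convex \<mu> \<phi>1 \<longrightarrow> \<delta> > 0 \<longrightarrow>
     bounded (edom \<phi>2) \<longrightarrow> diameter (edom \<phi>2) \<le> D \<longrightarrow> x \<in> edom \<phi>2 \<longrightarrow>
     apgmu \<mu> \<phi>1 \<phi>2 L \<delta> x = (y, ops) \<longrightarrow>
       y \<in> edom \<phi>2 \<and> subdiff (esum \<phi>1 \<phi>2) y \<noteq> {} \<and> infdist 0 (subdiff (esum \<phi>1 \<phi>2) y) \<le> \<delta> \<and>
       (\<exists>pg_ops. real pg_ops \<le> K * (sqrt (L / \<mu>) * (1 + real (nat \<lceil>log 2 (L * D / \<delta>)\<rceil>))) \<and>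
          ops \<le> \<kappa> * pg_ops))"


section \<open>The routines\<close>

text \<open>The routines live in the option monad, with \<^const>\<open>None\<close> standing for non-termination
  (the least fixed point of \<open>partial_function (option)\<close>). The last component of every state and
  result counts the basic operations performed so far.

  The parameter \<open>A\<close> maps a multiplier \<open>z\<close> to the approximate solution \<open>A(z)\<close> and the cost of
  computing it and evaluating \<open>\<psi>\<close> there; \<open>\<psi>\<close>, \<open>\<epsilon>\<^sub>2\<close>, \<open>\<epsilon>\<^sub>3\<close> are as in the routine.\<close>

partial_function (option) dual_search ::
  "(real \<Rightarrow> 'a \<times> nat) \<Rightarrow> ('a \<Rightarrow> ereal) \<Rightarrow> real \<Rightarrow> real \<Rightarrow> real \<Rightarrow> real \<Rightarrow> 'a \<Rightarrow> 'a \<Rightarrow> nat \<Rightarrow>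
   (real \<times> real \<times> 'a \<times> 'a \<times> nat) option" where
  "dual_search A \<psi> \<epsilon>2 M a b xa xb n =
     (if max 0 (\<psi> xb) > ereal \<epsilon>2 \<and> b < M
      then let (xb', k) = A (2 * b) in dual_search A \<psi> \<epsilon>2 M b (2 * b) xb xb' (n + k)
      else Some (a, b, xa, xb, n))"

partial_function (option) dual_bisect ::
  "(real \<Rightarrow> 'a \<times> nat) \<Rightarrow> ('a \<Rightarrow> ereal) \<Rightarrow> real \<Rightarrow> real \<Rightarrow> real \<Rightarrow> real \<Rightarrow> real \<Rightarrow> 'a \<Rightarrow> 'a \<Rightarrow> nat \<Rightarrow>
   (('a \<times> real) \<times> nat) option" where
  "dual_bisect A \<psi> \<epsilon>2 \<epsilon>3 tol a b xa xb n =
     (if b - a > tol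
      then let z = (a + b) / 2; (x, k) = A z in
        if max 0 (\<psi> x) > ereal \<epsilon>2 then dual_bisect A \<psi> \<epsilon>2 \<epsilon>3 tol z b x xb (n + k)
        else if \<bar>ereal z * \<psi> x\<bar> \<le> ereal \<epsilon>3 then Some ((x, z), n + k)
        else dual_bisect A \<psi> \<epsilon>2 \<epsilon>3 tol a z xa x (n + k)
      else Some ((xb, b), n))"

text \<open>\<open>L\<phi>\<close> and \<open>L\<psi>\<close> are gradient Lipschitz constants of \<open>\<phi>\<^sub>1\<close> and \<open>\<psi>\<^sub>1\<close>.
  The 2 added to the cost of \<open>A(z)\<close> is for evaluating \<open>\<psi>\<^sub>1\<close> and \<open>\<psi>\<^sub>2\<close> at the new point.\<close>

definition dual ::
  "'a apgmu \<Rightarrow> ('a \<Rightarrow> real) \<Rightarrow> ('a \<Rightarrow> ereal) \<Rightarrow> real \<Rightarrow> real \<Rightarrow> ('a \<Rightarrow> real) \<Rightarrow> ('a \<Rightarrow> ereal) \<Rightarrow> real \<Rightarrow>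
   real \<Rightarrow> real \<Rightarrow> 'a \<Rightarrow> real \<Rightarrow> (('a \<times> real) \<times> nat) option" where
  "dual apgmu \<phi>1 \<phi>2 \<mu> L\<phi> \<psi>1 \<psi>2 L\<psi> \<sigma> M x_init \<delta> =
     (let \<epsilon>1 = \<mu> * \<delta>\<^sup>2; \<epsilon>2 = \<delta>; \<epsilon>3 = 4 * M * \<delta>; \<psi> = esum \<psi>1 \<psi>2;
          A = (\<lambda>z. let (x, k) = apgmu \<mu> (\<lambda>x. \<phi>1 x + z * \<psi>1 x) (\<lambda>x. \<phi>2 x + ereal z * \<psi>2 x)
                                  (L\<phi> + z * L\<psi>) \<epsilon>1 x_init
                   in (x, k + 2));
          (x0, k0) = A 0
      in if max 0 (\<psi> x0) \<le> ereal \<epsilon>2 then Some ((x0, 0), k0)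
         else let (x\<sigma>, k\<sigma>) = A \<sigma> in do {
           (a, b, xa, xb, n) \<leftarrow> dual_search A \<psi> \<epsilon>2 M 0 \<sigma> x0 x\<sigma> (k0 + k\<sigma>);
           if \<bar>ereal b * \<psi> xb\<bar> \<le> ereal \<epsilon>3 then Some ((xb, b), n)
           else dual_bisect A \<psi> \<epsilon>2 \<epsilon>3 (\<mu> * \<delta> ^ 3) a b xa xb n
         })"

text \<open>One round of the main loop up to the stopping test. The 8 is for evaluating \<open>f\<close> at \<open>x\<^sub>f\<close> and
  \<open>g\<close> at \<open>x\<^sub>f\<close>, at the reference point \<open>x\<^sub>g\<close> and, for the test, at \<open>x\<close>.\<close>

definition lb_init_round ::
  "('a::euclidean_space) apg0 \<Rightarrow> 'a apgmu \<Rightarrow>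
   ('a \<Rightarrow> real) \<Rightarrow> ('a \<Rightarrow> ereal) \<Rightarrow> ('a \<Rightarrow> real) \<Rightarrow> ('a \<Rightarrow> ereal) \<Rightarrow> real \<Rightarrow> real \<Rightarrow> real \<Rightarrow>
   real \<Rightarrow> 'a \<Rightarrow> 'a \<Rightarrow> 'a \<Rightarrow> (real \<times> real \<times> 'a \<times> real \<times> 'a \<times> 'a \<times> nat) option" where
  "lb_init_round apg0 apgmu f1 f2 g1 g2 Lf Lg D \<Delta>0 xf0 xg0 x0 =
     (let \<Delta> = \<Delta>0 / 2;
          (xf, kf) = apg0 f1 (\<lambda>x. f2 x + indic (edom g2) x) Lf \<Delta> xf0 D;
          (xg, kg) = apg0 g1 g2 Lg \<Delta> xg0 D;
          l = real_of_ereal (esum f1 f2 xf) + \<Delta>;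
          M = max ((real_of_ereal (esum g1 g2 xf) - real_of_ereal (esum g1 g2 xg) + 1) / \<Delta>) 1;
          C = 4 * C_D D * M;
          \<eta> = \<Delta> / C_D D
      in do {
        ((x, z), k) \<leftarrow> dual apgmu (\<lambda>y. g1 y + \<eta> / 2 * (norm (y - xf))\<^sup>2) g2 \<eta> (Lg + \<eta>)
                          (\<lambda>y. f1 y - l) f2 Lf 1 M x0 (\<Delta> / C);
        Some (l, \<Delta>, xf, M, xg, x, kf + kg + k + 8)
      })"

partial_function (option) lb_init_loop ::
  "(real \<Rightarrow> 'a \<Rightarrow> 'a \<Rightarrow> 'a \<Rightarrow> (real \<times> real \<times> 'a \<times> real \<times> 'a \<times> 'a \<times> nat) option) \<Rightarrow> ('a \<Rightarrow> ereal) \<Rightarrow>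
   real \<Rightarrow> 'a \<Rightarrow> 'a \<Rightarrow> 'a \<Rightarrow> nat \<Rightarrow> ((real \<times> real \<times> 'a \<times> real) \<times> nat) option" where
  "lb_init_loop step g \<Delta>0 xf0 xg0 x0 n = do {
     (l, \<Delta>, xf, M, xg, x, k) \<leftarrow> step \<Delta>0 xf0 xg0 x0;
     if g x - g xg > ereal \<Delta> then Some ((l, \<Delta>, xf, M), n + k)
     else lb_init_loop step g \<Delta> xf xg x (n + k)
   }"

text \<open>As in the pseudo-code, \<open>Bf\<close> is an argument although the routine does not read it.\<close>

definition lb_init ::
  "('a::euclidean_space) apg0 \<Rightarrow> 'a apgmu \<Rightarrow>
   ('a \<Rightarrow> real) \<Rightarrow> ('a \<Rightarrow> ereal) \<Rightarrow> ('a \<Rightarrow> real) \<Rightarrow> ('a \<Rightarrow> ereal) \<Rightarrow> real \<Rightarrow> real \<Rightarrow>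
   real \<Rightarrow> real \<Rightarrow> real \<Rightarrow> 'a \<Rightarrow> 'a \<Rightarrow> ((real \<times> real \<times> 'a \<times> real) \<times> nat) option" where
  "lb_init apg0 apgmu f1 f2 g1 g2 Lf Lg d_init D Bf xf_init xg_init =
     lb_init_loop (lb_init_round apg0 apgmu f1 f2 g1 g2 Lf Lg D) (esum g1 g2)
       (2 * d_init) xf_init xg_init xf_init 0"


section \<open>The constant hidden in the complexity bound\<close>

text \<open>\<open>K0\<close>, \<open>K\<mu>\<close> are the constants in the complexity bounds of the two subroutines and \<open>\<kappa>\<close> bounds
  the number of basic operations in a proximal-gradient operation. The constant is written out,
  instead of being quantified existentially in the theorem, because an existential constant could
  depend on the type of points, that is, on the dimension. The numerical factor is not
  optimized.\<close>

definition hidden_const :: "real \<Rightarrow> real \<Rightarrow> nat \<Rightarrow> real \<Rightarrow> real \<Rightarrow> real \<Rightarrow> real \<Rightarrow> real" where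
  "hidden_const K0 K\<mu> \<kappa> D \<Omega> Lf Lg =
     10 ^ 6 * (1 + real \<kappa> * (K0 + K\<mu>)) *
     (1 + ln (1 + D) + ln (1 + \<Omega>) + ln (1 + Lf) + ln (1 + Lg))\<^sup>2"

end

theory Submission
  imports Defs
begin

text \<open>
  Write \<open>S\<close> for the domain of \<open>g2\<close> and consider a round with tolerance \<open>\<Delta>\<close>. The dual routine is
  applied to the problem of minimizing \<open>g + \<eta>/2 * (norm (x - x\<^sub>f))\<^sup>2\<close> subject to
  \<open>f x \<le> l\<close>. As \<open>f x\<^sub>f = l - \<Delta>\<close>, the point \<open>x\<^sub>f\<close> is a Slater point, and the number \<open>M\<close> is
  chosen such that \<open>g x\<^sub>f - g\<^sup>* \<le> M \<Delta>\<close>. An approximate stationarity bound for strongly convex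
  functions (\<open>approximately_stationary\<close>) turns the guarantee of \<open>apgmu\<close> into inequalities between
  function values, and all facts on the round follow by comparing the computed point with
  suitable points of \<open>S\<close>:

  \<^item> compared with \<open>x\<^sub>f\<close>, it is feasible up to \<open>\<delta>\<close> if the multiplier is at least \<open>M\<close>
    (\<open>oracle_feasible\<close>), so the interval search ends with a bracketing interval within \<open>[0, 2M]\<close>;
  \<^item> compared with each other, the points at the ends of a short interval are so close that the
    interval cannot separate infeasible from strictly feasible ones (\<open>oracle_gap\<close>), so the bisection
    stops at a nearly feasible point with small complementarity error;
  \<^item> compared with a solution of the bilevel problem, the returned point satisfies
    \<open>g x \<le> g\<^sup>* + \<Delta>\<close> whenever \<open>p\<^sup>* \<le> l\<close> (\<open>oracle_optimal\<close>). So if the test of the main loop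
    succeeds, then \<open>l < p\<^sup>*\<close>, and the round yields a reference certificate.

  Conversely, if \<open>\<Delta> < 2/Q\<close>, then \<open>l\<close> is at most the midpoint of \<open>f\<^sup>*\<close> and \<open>p\<^sup>*\<close>. By convexity along the
  segment to \<open>x\<^sub>f\<close>, every nearly feasible point has a \<open>g\<close>-value of at least
  \<open>g\<^sup>* + m\<^sub>0 - \<Delta>/4\<close>, and the test succeeds (\<open>test_succeeds\<close>). That \<open>m\<^sub>0\<close> is positive follows from
  compactness (\<open>m0_pos\<close>). Hence the last tolerance is at least \<open>1/Q\<close>.

  For the cost, a round makes a number of calls of \<open>apgmu\<close> that is logarithmic in the data
  (\<open>number_of_calls_le\<close>), each of which is governed by the square root of a condition number
  (\<open>sqrt_condition_le\<close>) times another logarithm (\<open>log_accuracy_le\<close>). Up to logarithms a round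
  costs \<open>sqrt (C_D * L\<^sub>f * \<Omega>) / \<Delta> + sqrt (C_D * L\<^sub>g / \<Delta>)\<close>. Since \<open>\<Delta>\<close> is halved from round to
  round, these costs form geometric sums dominated by the last round.
\<close>

section \<open>Lower semicontinuous convex extended-valued functions\<close>

lemma lsc_add:
  assumes "lsc h1" "lsc h2" "\<And>x. h1 x \<noteq> -\<infinity>" "\<And>x. h2 x \<noteq> -\<infinity>"
  shows "lsc (\<lambda>x. h1 x + h2 x)"
  unfolding lsc_def le_Liminf_iff
proof (intro allI impI)
  fix x y assume y: "y < h1 x + h2 x"
  have "\<exists>a b. a < h1 x \<and> b < h2 x \<and> y \<le> a + b"
  proof (cases "y = -\<infinity>")
    case True
    then show ?thesis using assms(3)[of x] assms(4)[of x] by (intro exI[of _ "-\<infinity>"]) auto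
  next
    case False
    then obtain r where r: "y = ereal r" using y by (cases y) auto
    show ?thesis
    proof (cases "h1 x")
      case (real r1)
      show ?thesis
      proof (cases "h2 x")
        case r2: (real r2)
        then show ?thesis using real r y
          by (intro exI[of _ "ereal (r1 - (r1 + r2 - r) / 2)"]
              exI[of _ "ereal (r2 - (r1 + r2 - r) / 2)"]) (auto simp: field_simps)
      next
        case PInf
        then show ?thesis using real r
          by (intro exI[of _ "ereal (r1 - 1)"] exI[of _ "ereal (r - r1 + 1)"]) auto
      qed (use assms(4)[of x] in auto)
    next
      case PInf
      obtain b where b: "ereal b < h2 x" using assms(4)[of x]
        by (metis ereal_dense2 ereal_infty_less(2))
      show ?thesis using PInf r b
        by (intro exI[of _ "ereal (r - b)"] exI[of _ "ereal b"]) auto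
    qed (use assms(3)[of x] in auto)
  qed
  then obtain a b where ab: "a < h1 x" "b < h2 x" "y \<le> a + b" by blast
  have "\<forall>\<^sub>F z in at x. a < h1 z" "\<forall>\<^sub>F z in at x. b < h2 z"
    using assms(1,2) ab unfolding lsc_def le_Liminf_iff by blast+
  then show "\<forall>\<^sub>F z in at x. y < h1 z + h2 z"
    by eventually_elim (use ab in \<open>metis ereal_add_strict_mono2 le_less_trans\<close>)
qed

lemma lsc_cmult:
  fixes h :: "'a::{perfect_space,t2_space} \<Rightarrow> ereal"
  assumes "lsc h" "0 \<le> z"
  shows "lsc (\<lambda>x. ereal z * h x)"
  unfolding lsc_def
proof
  fix x
  have "ereal z * h x \<le> ereal z * Liminf (at x) h"
    using assms by (intro ereal_mult_left_mono) (auto simp: lsc_def)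
  also have "\<dots> = Liminf (at x) (\<lambda>x. ereal z * h x)"
    by (rule Liminf_ereal_mult_left[symmetric]) (use assms in auto)
  finally show "ereal z * h x \<le> Liminf (at x) (\<lambda>x. ereal z * h x)" .
qed

lemma lsc_indic:
  assumes "closed C"
  shows "lsc (indic C)"
  unfolding lsc_def le_Liminf_iff
proof (intro allI impI)
  fix x y assume y: "y < indic C x"
  show "\<forall>\<^sub>F z in at x. y < indic C z"
  proof (cases "x \<in> C")
    case True
    then show ?thesis using y by (auto simp: indic_def)
  next
    case False
    then have "\<forall>\<^sub>F z in at x. z \<in> - C"
      using assms by (intro eventually_at_topological[THEN iffD2]) (auto simp: closed_def)
    then show ?thesis by eventually_elim (use y False in \<open>auto simp: indic_def\<close>)
  qed
qed

lemma econvex_add: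
  assumes "econvex h1" "econvex h2" "\<And>x. h1 x \<noteq> -\<infinity>" "\<And>x. h2 x \<noteq> -\<infinity>"
  shows "econvex (\<lambda>x. h1 x + h2 x)"
  unfolding econvex_def
proof (intro allI ballI)
  fix x y and t :: real assume t: "t \<in> {0..1}"
  have "h1 ((1 - t) *\<^sub>R x + t *\<^sub>R y) + h2 ((1 - t) *\<^sub>R x + t *\<^sub>R y)
    \<le> (ereal (1 - t) * h1 x + ereal t * h1 y) + (ereal (1 - t) * h2 x + ereal t * h2 y)"
    using assms(1,2) t unfolding econvex_def by (intro add_mono) blast+
  also have "\<dots> = ereal (1 - t) * (h1 x + h2 x) + ereal t * (h1 y + h2 y)"
    using assms(3,4) by (simp add: ereal_distrib_left ac_simps)
  finally show "h1 ((1 - t) *\<^sub>R x + t *\<^sub>R y) + h2 ((1 - t) *\<^sub>R x + t *\<^sub>R y)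
    \<le> ereal (1 - t) * (h1 x + h2 x) + ereal t * (h1 y + h2 y)" .
qed

lemma econvex_cmult:
  assumes "econvex h" "0 \<le> z" "\<And>x. h x \<noteq> -\<infinity>"
  shows "econvex (\<lambda>x. ereal z * h x)"
  unfolding econvex_def
proof (intro allI ballI)
  fix x y and t :: real assume t: "t \<in> {0..1}"
  have "ereal z * h ((1 - t) *\<^sub>R x + t *\<^sub>R y)
    \<le> ereal z * (ereal (1 - t) * h x + ereal t * h y)"
    using assms t unfolding econvex_def by (intro ereal_mult_left_mono) auto
  also have "\<dots> = ereal z * (ereal (1 - t) * h x) + ereal z * (ereal t * h y)"
    using assms(3)[of x] assms(3)[of y] t by (intro ereal_distrib_left) auto
  finally show "ereal z * h ((1 - t) *\<^sub>R x + t *\<^sub>R y)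
    \<le> ereal (1 - t) * (ereal z * h x) + ereal t * (ereal z * h y)"
    by (simp add: ac_simps)
qed

lemma econvex_indic:
  assumes "convex C"
  shows "econvex (indic C)"
  unfolding econvex_def
proof (intro allI ballI)
  fix x y and t :: real assume t: "t \<in> {0..1}"
  consider "t = 0" | "t = 1" | "0 < t" "t < 1" using t by force
  then show "indic C ((1 - t) *\<^sub>R x + t *\<^sub>R y) \<le> ereal (1 - t) * indic C x + ereal t * indic C y"
  proof cases
    case 3
    then show ?thesis using convexD[OF assms, of x y "1 - t" t] by (auto simp: indic_def)
  qed (auto simp: zero_ereal_def[symmetric])
qed

lemma convex_on_real_of_econvex:
  assumes "econvex h" "\<And>x. h x \<noteq> -\<infinity>" "convex C" "C \<subseteq> edom h"
  shows "convex_on C (\<lambda>x. real_of_ereal (h x))"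
proof (rule convex_onI[OF _ assms(3)])
  fix t x y assume t: "0 < t" "t < (1::real)" and xy: "x \<in> C" "y \<in> C"
  define w where "w = (1 - t) *\<^sub>R x + t *\<^sub>R y"
  have w: "w \<in> C" unfolding w_def using xy t assms(3) by (auto intro: convexD)
  have fin: "\<exists>r. h v = ereal r" if "v \<in> C" for v
    using that assms(2)[of v] assms(4) by (cases "h v") (auto simp: edom_def)
  obtain a b c where "h x = ereal a" "h y = ereal b" "h w = ereal c"
    using fin xy w by metis
  moreover have "h w \<le> ereal (1 - t) * h x + ereal t * h y"
    using assms(1) t unfolding econvex_def w_def by auto
  ultimately show "real_of_ereal (h w) \<le> (1 - t) * real_of_ereal (h x) + t * real_of_ereal (h y)"
    by simp
qed


section \<open>Smooth summands\<close>

lemma lipschitz_gradient_add: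
  assumes "lipschitz_gradient L1 h1" "lipschitz_gradient L2 h2"
  shows "lipschitz_gradient (L1 + L2) (\<lambda>x. h1 x + h2 x)"
proof -
  from assms obtain G1 G2 where "\<forall>x. GDERIV h1 x :> G1 x" "L1-lipschitz_on UNIV G1"
    "\<forall>x. GDERIV h2 x :> G2 x" "L2-lipschitz_on UNIV G2"
    unfolding lipschitz_gradient_def by blast
  then show ?thesis unfolding lipschitz_gradient_def
    by (intro exI[of _ "\<lambda>x. G1 x + G2 x"]) (auto intro: GDERIV_add lipschitz_on_add)
qed

lemma lipschitz_gradient_cmult:
  fixes h :: "'a::real_inner \<Rightarrow> real"
  assumes "lipschitz_gradient L h" "0 \<le> z"
  shows "lipschitz_gradient (z * L) (\<lambda>x. z * (h x - l))"
proof -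
  from assms obtain G where G: "\<forall>x. GDERIV h x :> G x" "L-lipschitz_on UNIV G"
    unfolding lipschitz_gradient_def by blast
  have "GDERIV (\<lambda>x. z * (h x - l)) x :> z *\<^sub>R G x" for x
  proof -
    have "(h has_derivative (\<lambda>k. k \<bullet> G x)) (at x)" using G by (simp add: gderiv_def)
    then show ?thesis unfolding gderiv_def by (auto intro!: derivative_eq_intros)
  qed
  then show ?thesis unfolding lipschitz_gradient_def
    using lipschitz_on_cmult_nonneg[OF G(2) assms(2)] by (intro exI[of _ "\<lambda>x. z *\<^sub>R G x"]) auto
qed

lemma lipschitz_gradient_quadratic:
  assumes "0 \<le> \<eta>"
  shows "lipschitz_gradient \<eta> (\<lambda>x. \<eta> / 2 * (norm (x - c))\<^sup>2)"
  unfolding lipschitz_gradient_def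
proof (intro exI conjI allI)
  show "GDERIV (\<lambda>x. \<eta> / 2 * (norm (x - c))\<^sup>2) x :> \<eta> *\<^sub>R (x - c)" for x
    unfolding gderiv_def power2_norm_eq_inner
    by (auto intro!: derivative_eq_intros simp: inner_commute algebra_simps)
  show "\<eta>-lipschitz_on UNIV (\<lambda>x. \<eta> *\<^sub>R (x - c))"
    using assms by (auto simp: lipschitz_on_def dist_norm simp flip: scaleR_diff_right)
qed

lemma norm_convex_combination_sq:
  fixes x y c :: "'a::real_inner"
  shows "(norm ((1 - t) *\<^sub>R x + t *\<^sub>R y - c))\<^sup>2
    = (1 - t) * (norm (x - c))\<^sup>2 + t * (norm (y - c))\<^sup>2 - t * (1 - t) * (norm (x - y))\<^sup>2"
proof -
  have "(1 - t) *\<^sub>R x + t *\<^sub>R y - c = (1 - t) *\<^sub>R (x - c) + t *\<^sub>R (y - c)"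
    by (simp add: algebra_simps)
  moreover have "x - y = (x - c) - (y - c)" by simp
  ultimately show ?thesis
    unfolding power2_norm_eq_inner
    by (simp only: inner_diff_left inner_diff_right inner_add_left inner_add_right
        inner_scaleR_left inner_scaleR_right inner_commute) (simp add: algebra_simps)
qed

lemma strongly_convex_add_quadratic:
  assumes "convex_on UNIV h"
  shows "strongly_convex \<eta> (\<lambda>x. h x + \<eta> / 2 * (norm (x - c))\<^sup>2)"
  unfolding strongly_convex_def
proof (intro allI ballI)
  fix x y and t :: real assume "t \<in> {0..1}"
  then have "h ((1 - t) *\<^sub>R x + t *\<^sub>R y) \<le> (1 - t) * h x + t * h y"
    using convex_onD[OF assms, of t x y] by auto
  then show "h ((1 - t) *\<^sub>R x + t *\<^sub>R y) + \<eta> / 2 * (norm ((1 - t) *\<^sub>R x + t *\<^sub>R y - c))\<^sup>2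
    \<le> (1 - t) * (h x + \<eta> / 2 * (norm (x - c))\<^sup>2) + t * (h y + \<eta> / 2 * (norm (y - c))\<^sup>2)
      - \<eta> / 2 * t * (1 - t) * (norm (x - y))\<^sup>2"
    unfolding norm_convex_combination_sq by (simp add: field_simps)
qed

lemma strongly_convex_imp_convex_on:
  fixes h :: "'a::real_inner \<Rightarrow> real"
  assumes "strongly_convex \<mu> h" "0 \<le> \<mu>"
  shows "convex_on UNIV h"
proof (rule convex_onI)
  fix t :: real and x y :: 'a assume t: "0 < t" "t < 1"
  have "0 \<le> \<mu> / 2 * t * (1 - t) * (norm (x - y))\<^sup>2" using t assms by auto
  moreover have "h ((1 - t) *\<^sub>R x + t *\<^sub>R y)
       \<le> (1 - t) * h x + t * h y - \<mu> / 2 * t * (1 - t) * (norm (x - y))\<^sup>2"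
    using assms(1) t unfolding strongly_convex_def by auto
  ultimately show "h ((1 - t) *\<^sub>R x + t *\<^sub>R y) \<le> (1 - t) * h x + t * h y" by linarith
qed auto

text \<open>A point with a subgradient of norm at most \<open>\<epsilon>\<close> (up to closure) minimizes a strongly convex
  function up to the error \<open>\<epsilon> r\<close>, where \<open>r\<close> is the distance to the point compared with; strong
  convexity improves the bound by \<open>\<mu> r\<^sup>2 / 2\<close>.\<close>

lemma approximately_stationary:
  fixes \<phi>1 :: "'a::real_inner \<Rightarrow> real"
  assumes sc: "strongly_convex \<mu> \<phi>1" and cv: "econvex \<phi>2"
    and x: "\<phi>2 x = ereal u" and y: "\<phi>2 y = ereal v"
    and ne: "subdiff (esum \<phi>1 \<phi>2) x \<noteq> {}" and inf: "infdist 0 (subdiff (esum \<phi>1 \<phi>2) x) \<le> \<epsilon>"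
  shows "\<phi>1 x + u + \<mu> / 2 * (norm (y - x))\<^sup>2 - \<epsilon> * norm (y - x) \<le> \<phi>1 y + v"
proof -
  define r where "r = norm (y - x)"
  define d where "d = \<phi>1 y + v - (\<phi>1 x + u)"
  have seg: "t * (- (s * r)) \<le> t * (d - \<mu> / 2 * (1 - t) * r\<^sup>2)"
    if w: "w \<in> subdiff (esum \<phi>1 \<phi>2) x" "norm w \<le> s" and t: "0 < t" "t < 1" for s t w
  proof -
    define p where "p = (1 - t) *\<^sub>R x + t *\<^sub>R y"
    have px: "p - x = t *\<^sub>R (y - x)" by (simp add: p_def algebra_simps)
    have "esum \<phi>1 \<phi>2 x + ereal (w \<bullet> (p - x)) \<le> esum \<phi>1 \<phi>2 p"
      using w(1) by (simp add: subdiff_def)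
    also have "\<dots> \<le> ereal (\<phi>1 p) + (ereal (1 - t) * \<phi>2 x + ereal t * \<phi>2 y)"
      using cv t unfolding econvex_def esum_def p_def by (intro add_left_mono) auto
    finally have 1: "\<phi>1 x + u + t * (w \<bullet> (y - x)) \<le> \<phi>1 p + ((1 - t) * u + t * v)"
      by (simp add: x y esum_def px)
    have 2: "\<phi>1 p \<le> (1 - t) * \<phi>1 x + t * \<phi>1 y - \<mu> / 2 * t * (1 - t) * r\<^sup>2"
      using sc t unfolding strongly_convex_def p_def r_def norm_minus_commute[of y] by auto
    have "\<bar>w \<bullet> (y - x)\<bar> \<le> s * r"
      using Cauchy_Schwarz_ineq2[of w "y - x"] mult_right_mono[OF w(2), of r] by (simp add: r_def)
    then have "- (s * r) \<le> w \<bullet> (y - x)" by linarith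
    then have "t * (- (s * r)) \<le> t * (w \<bullet> (y - x))" using t by (intro mult_left_mono) auto
    then show ?thesis using 1 2 unfolding d_def by (simp add: algebra_simps)
  qed
  have le: "- (s * r) \<le> d - \<mu> / 2 * r\<^sup>2"
    if w: "w \<in> subdiff (esum \<phi>1 \<phi>2) x" "norm w \<le> s" for s w
  proof -
    have "((\<lambda>t. d - \<mu> / 2 * (1 - t) * r\<^sup>2) \<longlongrightarrow> d - \<mu> / 2 * (1 - 0) * r\<^sup>2) (at_right 0)"
      by (intro tendsto_intros)
    moreover have "\<forall>\<^sub>F t in at_right (0::real). - (s * r) \<le> d - \<mu> / 2 * (1 - t) * r\<^sup>2"
      unfolding eventually_at_right_field
      using seg[OF w] by (intro exI[of _ 1]) (auto simp only: mult_le_cancel_left_pos zero_less_one)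
    ultimately show ?thesis by (simp add: tendsto_lowerbound)
  qed
  have "- (\<epsilon> * r) \<le> d - \<mu> / 2 * r\<^sup>2 + e" if e: "0 < e" for e
  proof -
    define k where "k = e / (1 + r)"
    have r: "0 \<le> r" by (simp add: r_def)
    then have k: "0 < k" "k * r \<le> e" using e by (auto simp: k_def field_simps)
    have "\<exists>w\<in>subdiff (esum \<phi>1 \<phi>2) x. dist 0 w < \<epsilon> + k"
      using inf ne k(1) cInf_lessD[of "(\<lambda>w. dist 0 w) ` subdiff (esum \<phi>1 \<phi>2) x" "\<epsilon> + k"]
      by (auto simp: infdist_notempty)
    then obtain w where w: "w \<in> subdiff (esum \<phi>1 \<phi>2) x" "norm w \<le> \<epsilon> + k" by auto
    show ?thesis using le[OF w] k(2) by (simp add: algebra_simps)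
  qed
  then have "- (\<epsilon> * r) \<le> d - \<mu> / 2 * r\<^sup>2" by (rule field_le_epsilon)
  then show ?thesis unfolding r_def d_def by simp
qed


section \<open>Interval search and bisection\<close>

text \<open>Here and below the result \<open>A(z)\<close> of the oracle is a pair of a point and the cost of computing
  it, and \<open>c\<close> bounds this cost for the multipliers that occur. After \<open>j\<close> doublings \<open>b\<close> has
  reached \<open>M\<close>, where the oracle is feasible.\<close>

lemma dual_search_terminates:
  assumes feas: "\<And>z. M \<le> z \<Longrightarrow> z \<le> 2 * M \<Longrightarrow> max 0 (\<psi> (fst (A z))) \<le> ereal \<epsilon>"
    and cost: "\<And>z. 0 \<le> z \<Longrightarrow> z \<le> 2 * M \<Longrightarrow> real (snd (A z)) \<le> c"
    and "0 \<le> a" "a < b" "b \<le> 2 * M" "M \<le> 2 ^ j * b"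
    and "max 0 (\<psi> (fst (A a))) > ereal \<epsilon>"
  shows "\<exists>a' b' n'. dual_search A \<psi> \<epsilon> M a b (fst (A a)) (fst (A b)) n
      = Some (a', b', fst (A a'), fst (A b'), n') \<and>
    0 \<le> a' \<and> a' < b' \<and> b' \<le> 2 * M \<and>
    max 0 (\<psi> (fst (A a'))) > ereal \<epsilon> \<and> max 0 (\<psi> (fst (A b'))) \<le> ereal \<epsilon> \<and>
    real n' \<le> real n + real j * c"
  using assms(3-)
proof (induction j arbitrary: a b n)
  case 0
  then have "max 0 (\<psi> (fst (A b))) \<le> ereal \<epsilon>" using feas[of b] by simp
  with 0 show ?case by (subst dual_search.simps) auto
next
  case (Suc j)
  have c: "0 \<le> c" using cost[of b] Suc.prems of_nat_0_le_iff order_trans by force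
  show ?case
  proof (cases "max 0 (\<psi> (fst (A b))) > ereal \<epsilon> \<and> b < M")
    case True
    define n1 where "n1 = n + snd (A (2 * b))"
    have eq: "dual_search A \<psi> \<epsilon> M a b (fst (A a)) (fst (A b)) n
        = dual_search A \<psi> \<epsilon> M b (2 * b) (fst (A b)) (fst (A (2 * b))) n1"
      using True by (subst dual_search.simps) (simp add: case_prod_beta n1_def)
    have "real n1 \<le> real n + c"
      using cost[of "2 * b"] Suc.prems True by (simp add: n1_def)
    moreover have "\<exists>a' b' n'. dual_search A \<psi> \<epsilon> M b (2 * b) (fst (A b)) (fst (A (2 * b))) n1
          = Some (a', b', fst (A a'), fst (A b'), n') \<and>
        0 \<le> a' \<and> a' < b' \<and> b' \<le> 2 * M \<and>
        max 0 (\<psi> (fst (A a'))) > ereal \<epsilon> \<and> max 0 (\<psi> (fst (A b'))) \<le> ereal \<epsilon> \<and>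
        real n' \<le> real n1 + real j * c"
      using Suc.prems True by (intro Suc.IH) (auto simp: mult.assoc mult.left_commute)
    ultimately show ?thesis unfolding eq by (fastforce simp: algebra_simps)
  next
    case False
    have "max 0 (\<psi> (fst (A b))) \<le> ereal \<epsilon>"
      using False feas[of b] Suc.prems(3) by (meson not_le)
    moreover have "dual_search A \<psi> \<epsilon> M a b (fst (A a)) (fst (A b)) n
        = Some (a, b, fst (A a), fst (A b), n)"
      using False by (subst dual_search.simps) auto
    ultimately show ?thesis using Suc.prems c
      by (intro exI[of _ a] exI[of _ b] exI[of _ n]) auto
  qed
qed

text \<open>The hypothesis \<open>gap\<close> says that an interval across which \<open>\<psi>\<close> drops from above \<open>\<epsilon>2\<close> to
  below \<open>\<epsilon>2\<close> and far from complementarity is longer than \<open>tol\<close>, so that the bisection always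
  ends inside its loop.\<close>

lemma dual_bisect_terminates:
  assumes gap: "\<And>a b. 0 \<le> a \<Longrightarrow> a < b \<Longrightarrow> b \<le> 2 * M \<Longrightarrow> max 0 (\<psi> (fst (A a))) > ereal \<epsilon>2 \<Longrightarrow>
      max 0 (\<psi> (fst (A b))) \<le> ereal \<epsilon>2 \<Longrightarrow> \<not> \<bar>ereal b * \<psi> (fst (A b))\<bar> \<le> ereal \<epsilon>3 \<Longrightarrow> tol < b - a"
    and cost: "\<And>z. 0 \<le> z \<Longrightarrow> z \<le> 2 * M \<Longrightarrow> real (snd (A z)) \<le> c"
    and "0 \<le> a" "a < b" "b \<le> 2 * M" "b - a \<le> 2 ^ j * tol"
    and "max 0 (\<psi> (fst (A a))) > ereal \<epsilon>2" "max 0 (\<psi> (fst (A b))) \<le> ereal \<epsilon>2"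
    and "\<not> \<bar>ereal b * \<psi> (fst (A b))\<bar> \<le> ereal \<epsilon>3"
  shows "\<exists>z n'. dual_bisect A \<psi> \<epsilon>2 \<epsilon>3 tol a b (fst (A a)) (fst (A b)) n = Some ((fst (A z), z), n') \<and>
    0 \<le> z \<and> z \<le> 2 * M \<and> max 0 (\<psi> (fst (A z))) \<le> ereal \<epsilon>2 \<and>
    \<bar>ereal z * \<psi> (fst (A z))\<bar> \<le> ereal \<epsilon>3 \<and> real n' \<le> real n + real j * c"
  using assms(3-)
proof (induction j arbitrary: a b n)
  case 0
  then show ?case using gap[of a b] by simp
next
  case (Suc j)
  have c: "0 \<le> c" using cost[of b] Suc.prems of_nat_0_le_iff order_trans by force
  have tol: "tol < b - a" using Suc.prems by (intro gap) auto
  define z where "z = (a + b) / 2"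
  have z: "0 \<le> z" "a < z" "z < b" "z \<le> 2 * M" "b - z \<le> 2 ^ j * tol" "z - a \<le> 2 ^ j * tol"
    using Suc.prems by (auto simp: z_def field_simps)
  define n1 where "n1 = n + snd (A z)"
  have n1: "real n1 \<le> real n + c" using cost[of z] z by (simp add: n1_def)
  have eq: "dual_bisect A \<psi> \<epsilon>2 \<epsilon>3 tol a b (fst (A a)) (fst (A b)) n =
    (if max 0 (\<psi> (fst (A z))) > ereal \<epsilon>2
     then dual_bisect A \<psi> \<epsilon>2 \<epsilon>3 tol z b (fst (A z)) (fst (A b)) n1
     else if \<bar>ereal z * \<psi> (fst (A z))\<bar> \<le> ereal \<epsilon>3 then Some ((fst (A z), z), n1)
     else dual_bisect A \<psi> \<epsilon>2 \<epsilon>3 tol a z (fst (A a)) (fst (A z)) n1)"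
    using tol by (subst dual_bisect.simps) (simp add: case_prod_beta Let_def z_def n1_def)
  have step: ?case
    if "\<exists>y n'. dual_bisect A \<psi> \<epsilon>2 \<epsilon>3 tol a b (fst (A a)) (fst (A b)) n = Some ((fst (A y), y), n') \<and>
      0 \<le> y \<and> y \<le> 2 * M \<and> max 0 (\<psi> (fst (A y))) \<le> ereal \<epsilon>2 \<and>
      \<bar>ereal y * \<psi> (fst (A y))\<bar> \<le> ereal \<epsilon>3 \<and> real n' \<le> real n1 + real j * c"
  proof -
    from that obtain y n' where y: "dual_bisect A \<psi> \<epsilon>2 \<epsilon>3 tol a b (fst (A a)) (fst (A b)) n
        = Some ((fst (A y), y), n')"
      "0 \<le> y" "y \<le> 2 * M" "max 0 (\<psi> (fst (A y))) \<le> ereal \<epsilon>2"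
      "\<bar>ereal y * \<psi> (fst (A y))\<bar> \<le> ereal \<epsilon>3" "real n' \<le> real n1 + real j * c" by blast
    then show ?thesis using n1 by (intro exI[of _ y] exI[of _ n']) (simp add: algebra_simps)
  qed
  consider "max 0 (\<psi> (fst (A z))) > ereal \<epsilon>2"
    | "max 0 (\<psi> (fst (A z))) \<le> ereal \<epsilon>2" "\<bar>ereal z * \<psi> (fst (A z))\<bar> \<le> ereal \<epsilon>3"
    | "max 0 (\<psi> (fst (A z))) \<le> ereal \<epsilon>2" "\<not> \<bar>ereal z * \<psi> (fst (A z))\<bar> \<le> ereal \<epsilon>3"
    by (meson not_le)
  then show ?case
  proof cases
    case 1
    then have rec: "dual_bisect A \<psi> \<epsilon>2 \<epsilon>3 tol a b (fst (A a)) (fst (A b)) n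
        = dual_bisect A \<psi> \<epsilon>2 \<epsilon>3 tol z b (fst (A z)) (fst (A b)) n1" unfolding eq by simp
    show ?thesis
      by (rule step, unfold rec, rule Suc.IH) (use 1 Suc.prems z in \<open>blast+\<close>)
  next
    case 2
    then have "dual_bisect A \<psi> \<epsilon>2 \<epsilon>3 tol a b (fst (A a)) (fst (A b)) n = Some ((fst (A z), z), n1)"
      unfolding eq by (simp add: not_less[symmetric])
    then show ?thesis using 2 z c by (intro step) (auto intro!: exI[of _ z])
  next
    case 3
    then have rec: "dual_bisect A \<psi> \<epsilon>2 \<epsilon>3 tol a b (fst (A a)) (fst (A b)) n
        = dual_bisect A \<psi> \<epsilon>2 \<epsilon>3 tol a z (fst (A a)) (fst (A z)) n1"
      unfolding eq by (simp add: not_less[symmetric])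
    show ?thesis
      by (rule step, unfold rec, rule Suc.IH) (use 3 Suc.prems z in \<open>blast+\<close>)
  qed
qed

text \<open>The map \<open>A\<close> of the routine \<^const>\<open>dual\<close>: the approximate minimizer of the Lagrangian
  \<open>\<phi> + z \<psi>\<close>, with the number of basic operations spent on it.\<close>

definition lagrangian_oracle ::
  "'a apgmu \<Rightarrow> ('a \<Rightarrow> real) \<Rightarrow> ('a \<Rightarrow> ereal) \<Rightarrow> real \<Rightarrow> real \<Rightarrow> ('a \<Rightarrow> real) \<Rightarrow> ('a \<Rightarrow> ereal) \<Rightarrow> real \<Rightarrow>
   'a \<Rightarrow> real \<Rightarrow> real \<Rightarrow> 'a \<times> nat" where
  "lagrangian_oracle apgmu \<phi>1 \<phi>2 \<mu> L\<phi> \<psi>1 \<psi>2 L\<psi> x_init \<delta> z =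
     (let (x, k) = apgmu \<mu> (\<lambda>x. \<phi>1 x + z * \<psi>1 x) (\<lambda>x. \<phi>2 x + ereal z * \<psi>2 x)
        (L\<phi> + z * L\<psi>) (\<mu> * \<delta>\<^sup>2) x_init in (x, k + 2))"

lemma dual_terminates:
  fixes apgmu :: "'a apgmu"
  assumes A_eq: "A = lagrangian_oracle apgmu \<phi>1 \<phi>2 \<mu> L\<phi> \<psi>1 \<psi>2 L\<psi> x_init \<delta>"
    and \<psi>_eq: "\<psi> = esum \<psi>1 \<psi>2"
    and feas: "\<And>z. M \<le> z \<Longrightarrow> z \<le> 2 * M \<Longrightarrow> max 0 (\<psi> (fst (A z))) \<le> ereal \<delta>"
    and gap: "\<And>a b. 0 \<le> a \<Longrightarrow> a < b \<Longrightarrow> b \<le> 2 * M \<Longrightarrow> max 0 (\<psi> (fst (A a))) > ereal \<delta> \<Longrightarrow>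
      max 0 (\<psi> (fst (A b))) \<le> ereal \<delta> \<Longrightarrow> \<not> \<bar>ereal b * \<psi> (fst (A b))\<bar> \<le> ereal (4 * M * \<delta>) \<Longrightarrow>
      \<mu> * \<delta> ^ 3 < b - a"
    and cost: "\<And>z. 0 \<le> z \<Longrightarrow> z \<le> 2 * M \<Longrightarrow> real (snd (A z)) \<le> c"
    and params: "0 < \<sigma>" "\<sigma> \<le> 2 * M" "0 < \<delta>" "M \<le> 2 ^ i * \<sigma>" "2 * M \<le> 2 ^ j * (\<mu> * \<delta> ^ 3)"
  shows "\<exists>z n. dual apgmu \<phi>1 \<phi>2 \<mu> L\<phi> \<psi>1 \<psi>2 L\<psi> \<sigma> M x_init \<delta> = Some ((fst (A z), z), n) \<and>
    0 \<le> z \<and> z \<le> 2 * M \<and> max 0 (\<psi> (fst (A z))) \<le> ereal \<delta> \<and>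
    \<bar>ereal z * \<psi> (fst (A z))\<bar> \<le> ereal (4 * M * \<delta>) \<and> real n \<le> real (2 + i + j) * c"
proof -
  define srch where "srch = dual_search A \<psi> \<delta> M 0 \<sigma> (fst (A 0)) (fst (A \<sigma>)) (snd (A 0) + snd (A \<sigma>))"
  have eq: "dual apgmu \<phi>1 \<phi>2 \<mu> L\<phi> \<psi>1 \<psi>2 L\<psi> \<sigma> M x_init \<delta> =
    (if max 0 (\<psi> (fst (A 0))) \<le> ereal \<delta> then Some ((fst (A 0), 0), snd (A 0))
     else srch \<bind> (\<lambda>(a, b, xa, xb, n).
       if \<bar>ereal b * \<psi> xb\<bar> \<le> ereal (4 * M * \<delta>) then Some ((xb, b), n)
       else dual_bisect A \<psi> \<delta> (4 * M * \<delta>) (\<mu> * \<delta> ^ 3) a b xa xb n))"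
    unfolding dual_def srch_def A_eq \<psi>_eq lagrangian_oracle_def
    by (simp add: Let_def case_prod_beta cong: if_cong)
  have M: "0 < M" using params by linarith
  have c: "0 \<le> c" using cost[of 0] M of_nat_0_le_iff order_trans by fastforce
  show ?thesis
  proof (cases "max 0 (\<psi> (fst (A 0))) \<le> ereal \<delta>")
    case True
    have "real (snd (A 0)) \<le> real (2 + i + j) * c"
      using cost[of 0] M c mult_right_mono[of 1 "real (2 + i + j)" c] by auto
    then show ?thesis unfolding eq using True M \<open>0 < \<delta>\<close>
      by (intro exI[of _ 0] exI[of _ "snd (A 0)"]) (auto simp: zero_ereal_def[symmetric])
  next
    case False
    then have viol: "max 0 (\<psi> (fst (A 0))) > ereal \<delta>" by (simp only: not_le)
    obtain a b n where abn: "srch = Some (a, b, fst (A a), fst (A b), n)"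
      "0 \<le> a" "a < b" "b \<le> 2 * M" "max 0 (\<psi> (fst (A a))) > ereal \<delta>"
      "max 0 (\<psi> (fst (A b))) \<le> ereal \<delta>" "real n \<le> real (snd (A 0) + snd (A \<sigma>)) + real i * c"
      using dual_search_terminates[where A=A and \<psi>=\<psi> and \<epsilon>=\<delta> and M=M and a=0 and b=\<sigma> and c=c and j=i
          and n="snd (A 0) + snd (A \<sigma>)", OF feas cost order_refl _ _ _ viol] params unfolding srch_def
      by blast
    have n: "real n \<le> real (2 + i) * c"
      using abn(7) cost[of 0] cost[of \<sigma>] M params by (simp add: algebra_simps)
    show ?thesis
    proof (cases "\<bar>ereal b * \<psi> (fst (A b))\<bar> \<le> ereal (4 * M * \<delta>)")
      case True
      have "real n \<le> real (2 + i + j) * c"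
        using n c mult_right_mono[of "real (2 + i)" "real (2 + i + j)" c] by auto
      then show ?thesis unfolding eq using False True abn
        by (intro exI[of _ b] exI[of _ n]) auto
    next
      case F2: False
      have "b - a \<le> 2 ^ j * (\<mu> * \<delta> ^ 3)" using abn params(5) by linarith
      then obtain z n' where "dual_bisect A \<psi> \<delta> (4 * M * \<delta>) (\<mu> * \<delta> ^ 3) a b (fst (A a)) (fst (A b)) n
          = Some ((fst (A z), z), n')" "0 \<le> z" "z \<le> 2 * M" "max 0 (\<psi> (fst (A z))) \<le> ereal \<delta>"
        "\<bar>ereal z * \<psi> (fst (A z))\<bar> \<le> ereal (4 * M * \<delta>)" "real n' \<le> real n + real j * c"
        using dual_bisect_terminates[where A=A and \<psi>=\<psi> and ?\<epsilon>2.0=\<delta> and ?\<epsilon>3.0="4*M*\<delta>" and M=M and a=a and b=b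
            and c=c and j=j and n=n, OF gap cost] F2 abn by blast
      then show ?thesis unfolding eq using False F2 abn(1) n
        by (intro exI[of _ z] exI[of _ n']) (auto simp: algebra_simps)
    qed
  qed
qed


section \<open>The bilevel problem in terms of real-valued functions\<close>

lemma min_val_eqI:
  assumes "x \<in> T" "h x = ereal r" "\<And>y. y \<in> T \<Longrightarrow> h x \<le> h y"
  shows "min_val h T = r"
proof -
  have "(INF y\<in>T. h y) = h x"
    using assms by (intro antisym INF_lower INF_greatest) auto
  then show ?thesis using assms(2) by (simp add: min_val_def)
qed

lemma lipschitz_gradient_imp_continuous_on:
  assumes "lipschitz_gradient L h"
  shows "continuous_on T h"
proof -
  obtain G where "\<And>x. GDERIV h x :> G x" using assms unfolding lipschitz_gradient_def by blast
  then have "isCont h x" for x unfolding gderiv_def by (meson has_derivative_continuous)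
  then show ?thesis by (simp add: continuous_at_imp_continuous_on)
qed

text \<open>The standing assumptions on the data. The domain of \<open>g2\<close> contains all points that matter: outside
  it \<open>g2\<close> is infinite, while \<open>f2\<close> is finite on it.\<close>

locale bilevel =
  fixes f1 g1 :: "'a::euclidean_space \<Rightarrow> real" and f2 g2 :: "'a \<Rightarrow> ereal" and Lf Lg D :: real
  assumes sbo: "sbo_problem f1 f2 g1 g2 Lf Lg"
    and asmA: "assumption_A f1 f2 g1 g2"
    and D_pos: "0 < D" and diam: "diameter (edom g2) \<le> D"
begin

abbreviation S :: "'a set" where "S \<equiv> edom g2"

text \<open>The real values of the two objectives, meaningful on the common domain \<open>S\<close>.\<close>

definition F :: "'a \<Rightarrow> real" where "F x = real_of_ereal (esum f1 f2 x)"
definition G :: "'a \<Rightarrow> real" where "G x = real_of_ereal (esum g1 g2 x)"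

abbreviation "fs \<equiv> f_star f1 f2 g2"
abbreviation "gs \<equiv> g_star g1 g2"
abbreviation "ps \<equiv> p_star f1 f2 g1 g2"
abbreviation "\<Omega> \<equiv> Omega_g g1 g2"
abbreviation "m \<equiv> m0 f1 f2 g1 g2"

lemma not_MInf: "f2 x \<noteq> -\<infinity>" "g2 x \<noteq> -\<infinity>"
  using sbo by (auto simp: sbo_problem_def proper_def)

lemma Lf_pos: "0 < Lf" and Lg_ge_1: "1 \<le> Lg"
  using sbo by (auto simp: sbo_problem_def)

lemma g2_eq:
  assumes "x \<in> S"
  shows "g2 x = ereal (G x - g1 x)"
  using assms not_MInf(2)[of x] by (cases "g2 x") (auto simp: edom_def G_def esum_def)

lemma f2_eq:
  assumes "x \<in> S"
  shows "f2 x = ereal (F x - f1 x)"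
proof -
  have "x \<in> edom f2" using assms asmA by (auto simp: assumption_A_def)
  then show ?thesis using not_MInf(1)[of x] by (cases "f2 x") (auto simp: edom_def F_def esum_def)
qed

lemma esum_f: "x \<in> S \<Longrightarrow> esum f1 f2 x = ereal (F x)"
  and esum_g: "x \<in> S \<Longrightarrow> esum g1 g2 x = ereal (G x)"
  by (simp_all add: esum_def f2_eq g2_eq)

lemma g2_outside: "x \<notin> S \<Longrightarrow> g2 x = \<infinity>"
  by (simp add: edom_def)

lemma esum_g_outside: "x \<notin> S \<Longrightarrow> esum g1 g2 x = \<infinity>"
  by (simp add: esum_def g2_outside)

lemma S_nonempty: "S \<noteq> {}" and S_compact: "compact S" and S_convex: "convex S"
  and S_subset: "S \<subseteq> edom f2" and fs_less_ps: "fs < ps"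
  using asmA by (auto simp: assumption_A_def)

lemma norm_diff_le_D:
  assumes "x \<in> S" "y \<in> S"
  shows "norm (x - y) \<le> D"
  using diameter_bounded_bound[OF compact_imp_bounded[OF S_compact] assms] diam
  by (simp add: dist_norm)

lemma convex_F: "convex_on S F" and convex_G: "convex_on S G"
proof -
  have eq: "(\<lambda>x. f1 x + real_of_ereal (f2 x)) x = F x" "(\<lambda>x. g1 x + real_of_ereal (g2 x)) x = G x"
    if "x \<in> S" for x using that by (auto simp: f2_eq g2_eq)
  have "convex_on S f1" "convex_on S g1"
    using sbo S_convex unfolding sbo_problem_def by (meson convex_on_subset subset_UNIV)+
  moreover have "convex_on S (\<lambda>x. real_of_ereal (f2 x))" "convex_on S (\<lambda>x. real_of_ereal (g2 x))"
    using sbo not_MInf S_convex S_subset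
    by (auto simp: sbo_problem_def intro: convex_on_real_of_econvex)
  ultimately have "convex_on S (\<lambda>x. f1 x + real_of_ereal (f2 x))"
    "convex_on S (\<lambda>x. g1 x + real_of_ereal (g2 x))" by (auto intro: convex_on_add)
  then show "convex_on S F" "convex_on S G"
    using eq by (auto simp: convex_on_def convex_def S_convex)
qed

lemma continuous_F: "continuous_on S F" and continuous_G: "continuous_on S G"
proof -
  have eq: "(\<lambda>x. f1 x + real_of_ereal (f2 x)) x = F x" "(\<lambda>x. g1 x + real_of_ereal (g2 x)) x = G x"
    if "x \<in> S" for x using that by (auto simp: f2_eq g2_eq)
  have "continuous_on S f1" "continuous_on S g1"
    using sbo unfolding sbo_problem_def by (blast intro: lipschitz_gradient_imp_continuous_on)+
  moreover have "continuous_on S (\<lambda>x. real_of_ereal (f2 x))"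
    using asmA by (auto simp: assumption_A_def intro: lipschitz_on_continuous_on)
  moreover have "continuous_on S (real_of_ereal \<circ> g2)"
    using asmA g2_eq by (subst continuous_on_iff_real[symmetric]) (auto simp: assumption_A_def)
  ultimately have "continuous_on S (\<lambda>x. f1 x + real_of_ereal (f2 x))"
    "continuous_on S (\<lambda>x. g1 x + real_of_ereal (g2 x))"
    by (auto simp: o_def intro: continuous_on_add)
  then show "continuous_on S F" "continuous_on S G" using eq by (simp_all cong: continuous_on_cong)
qed

lemma f_star_attained: "\<exists>x\<in>S. F x = fs" and f_star_le: "x \<in> S \<Longrightarrow> fs \<le> F x"
proof -
  obtain x0 where x0: "x0 \<in> S" "\<And>y. y \<in> S \<Longrightarrow> F x0 \<le> F y"
    using continuous_attains_inf[OF S_compact S_nonempty continuous_F] by blast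
  then have "fs = F x0" unfolding f_star_def
    by (intro min_val_eqI[of x0]) (auto simp: esum_f)
  with x0 show "\<exists>x\<in>S. F x = fs" "x \<in> S \<Longrightarrow> fs \<le> F x" by auto
qed

lemma g_star_attained: "\<exists>x\<in>S. G x = gs" and g_star_le: "x \<in> S \<Longrightarrow> gs \<le> G x"
proof -
  obtain x0 where x0: "x0 \<in> S" "\<And>y. y \<in> S \<Longrightarrow> G x0 \<le> G y"
    using continuous_attains_inf[OF S_compact S_nonempty continuous_G] by blast
  then have "gs = G x0" unfolding g_star_def
    by (intro min_val_eqI[of x0]) (auto simp: esum_g)
  with x0 show "\<exists>x\<in>S. G x = gs" "x \<in> S \<Longrightarrow> gs \<le> G x" by auto
qed

lemma argmin_g: "argmin (esum g1 g2) = {x \<in> S. G x = gs}"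
proof (intro set_eqI iffI)
  fix x assume "x \<in> argmin (esum g1 g2)"
  then have x: "\<And>y. \<not> esum g1 g2 y < esum g1 g2 x" by (auto simp: argmin_def is_arg_min_def)
  obtain x0 where x0: "x0 \<in> S" "G x0 = gs" using g_star_attained by blast
  with x[of x0] have "x \<in> S" by (cases "x \<in> S") (auto simp: esum_g esum_g_outside)
  with x[of x0] x0 g_star_le[of x] show "x \<in> {x \<in> S. G x = gs}" by (auto simp: esum_g)
next
  fix x assume x: "x \<in> {x \<in> S. G x = gs}"
  have "\<not> esum g1 g2 y < esum g1 g2 x" for y
    using x g_star_le[of y] by (cases "y \<in> S") (auto simp: esum_g esum_g_outside)
  then show "x \<in> argmin (esum g1 g2)" by (auto simp: argmin_def is_arg_min_def)
qed

lemma p_star_attained: "\<exists>x\<in>S. G x = gs \<and> F x = ps"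
  and p_star_le: "x \<in> S \<Longrightarrow> G x = gs \<Longrightarrow> ps \<le> F x"
proof -
  obtain x0 where "is_arg_min (esum f1 f2) (\<lambda>x. x \<in> argmin (esum g1 g2)) x0"
    using sbo unfolding sbo_problem_def by blast
  then have x0: "x0 \<in> S" "G x0 = gs" "\<And>y. y \<in> S \<Longrightarrow> G y = gs \<Longrightarrow> F x0 \<le> F y"
    by (auto simp: is_arg_min_def argmin_g esum_f not_less)
  then have "ps = F x0" unfolding p_star_def argmin_g
    by (intro min_val_eqI[of x0]) (auto simp: esum_f)
  with x0 show "\<exists>x\<in>S. G x = gs \<and> F x = ps" "x \<in> S \<Longrightarrow> G x = gs \<Longrightarrow> ps \<le> F x" by auto
qed

lemma m0_pos: "0 < m"
  and m0_le: "x \<in> S \<Longrightarrow> F x \<le> (ps + fs) / 2 \<Longrightarrow> gs + m \<le> G x"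
proof -
  define c where "c = (ps + fs) / 2"
  have c: "fs < c" "c < ps" using fs_less_ps by (auto simp: c_def)
  have "closed {x \<in> S. F x \<le> c}"
    using continuous_on_closed_Collect_le[OF continuous_F continuous_on_const
        compact_imp_closed[OF S_compact]] .
  then have "compact (S \<inter> {x \<in> S. F x \<le> c})" using S_compact by (intro compact_Int_closed)
  moreover have "S \<inter> {x \<in> S. F x \<le> c} = {x \<in> S. F x \<le> c}" by blast
  ultimately have "compact {x \<in> S. F x \<le> c}" by simp
  moreover have "{x \<in> S. F x \<le> c} \<noteq> {}" using f_star_attained c by force
  moreover have "continuous_on {x \<in> S. F x \<le> c} G"
    by (rule continuous_on_subset[OF continuous_G]) auto
  ultimately obtain x0 where "x0 \<in> {x \<in> S. F x \<le> c}" "\<forall>y\<in>{x \<in> S. F x \<le> c}. G x0 \<le> G y"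
    using continuous_attains_inf by blast
  then have x0: "x0 \<in> S" "F x0 \<le> c" "\<And>y. y \<in> S \<Longrightarrow> F y \<le> c \<Longrightarrow> G x0 \<le> G y" by auto
  have "esum g1 g2 x0 \<le> esum g1 g2 y" if "esum f1 f2 y \<le> ereal c" for y
    using x0 that by (cases "y \<in> S") (auto simp: esum_g esum_f esum_g_outside)
  then have "g_bar f1 f2 g1 g2 c = G x0" unfolding g_bar_def
    using x0 by (intro min_val_eqI[of x0]) (auto simp: esum_g esum_f)
  then have m: "m = G x0 - gs" by (simp add: m0_def c_def)
  have "G x0 \<noteq> gs" using p_star_le[OF x0(1)] x0(2) c by auto
  then show "0 < m" using g_star_le[OF x0(1)] m by simp
  show "x \<in> S \<Longrightarrow> F x \<le> (ps + fs) / 2 \<Longrightarrow> gs + m \<le> G x"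
    using x0(3)[of x] m by (simp add: c_def)
qed

lemma G_le_Omega: "x \<in> S \<Longrightarrow> G x - gs + 1 \<le> \<Omega>"
proof -
  have "compact (G ` S)" by (rule compact_continuous_image[OF continuous_G S_compact])
  then obtain B where "\<And>x. x \<in> S \<Longrightarrow> G x \<le> B"
    by (meson bdd_above_def bounded_imp_bdd_above compact_imp_bounded imageI)
  then have "bdd_above ((\<lambda>x. G x - gs + 1) ` S)" by (intro bdd_aboveI[of _ "B - gs + 1"]) auto
  then show "x \<in> S \<Longrightarrow> G x - gs + 1 \<le> \<Omega>"
    unfolding Omega_g_def G_def[symmetric] by (intro cSUP_upper) auto
qed

lemma Omega_ge_1: "1 \<le> \<Omega>"
  using g_star_attained G_le_Omega by force


section \<open>The composite problems handed to the subroutines\<close>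

lemma composite_f: "composite_problem f1 f2 g1 g2 f1 (\<lambda>x. f2 x + indic S x) Lf"
  and edom_f: "edom (\<lambda>x. f2 x + indic S x) = S"
proof -
  have "f2 x + indic S x < \<infinity> \<longleftrightarrow> x \<in> S" for x
    by (cases "x \<in> S") (simp_all add: indic_def f2_eq not_MInf)
  then show dom: "edom (\<lambda>x. f2 x + indic S x) = S" unfolding edom_def[of "\<lambda>x. f2 x + indic S x"] by blast
  have indic: "indic S x \<noteq> -\<infinity>" for x by (simp add: indic_def)
  have "computable_smooth f1 g1 f1" unfolding computable_smooth_def
    by (intro exI[of _ 1] exI[of _ 0] conjI) auto
  moreover have "lsc (\<lambda>x. f2 x + indic S x)"
    using sbo not_MInf indic by (intro lsc_add lsc_indic compact_imp_closed S_compact)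
      (auto simp: sbo_problem_def)
  moreover have "econvex (\<lambda>x. f2 x + indic S x)"
    using sbo not_MInf indic by (intro econvex_add econvex_indic S_convex)
      (auto simp: sbo_problem_def)
  moreover have "proper (\<lambda>x. f2 x + indic S x)"
    unfolding proper_def dom using S_nonempty not_MInf indic by auto
  ultimately show "composite_problem f1 f2 g1 g2 f1 (\<lambda>x. f2 x + indic S x) Lf"
    using sbo by (auto simp: composite_problem_def computable_prox_def sbo_problem_def)
qed

lemma composite_g: "composite_problem f1 f2 g1 g2 g1 g2 Lg"
proof -
  have "computable_smooth f1 g1 g1" unfolding computable_smooth_def
    by (rule exI[of _ 0], simp, rule exI[of _ 1], simp, rule exI[of _ 0], simp,
        rule exI[of _ 0], simp)
  moreover have "computable_prox f2 g2 g2" unfolding computable_prox_def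
    by (rule disjI1, rule exI[of _ 0]) (auto simp: zero_ereal_def[symmetric])
  ultimately show ?thesis using sbo by (auto simp: composite_problem_def sbo_problem_def)
qed

text \<open>The two summands of the Lagrangian of the regularized constrained problem: minimize
  \<open>g + \<eta>/2 * (norm (x - c))\<^sup>2\<close> subject to \<open>f x \<le> l\<close>, with the multiplier \<open>z\<close>.\<close>

context
  fixes \<eta> l z :: real and c :: 'a
  assumes \<eta>: "0 < \<eta>" and z: "0 \<le> z"
begin

abbreviation "lagr1 \<equiv> \<lambda>x. (g1 x + \<eta> / 2 * (norm (x - c))\<^sup>2) + z * (f1 x - l)"
abbreviation "lagr2 \<equiv> \<lambda>x. g2 x + ereal z * f2 x"

lemma lagr2_eq: "x \<in> S \<Longrightarrow> lagr2 x = ereal (G x - g1 x + z * (F x - f1 x))"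
  by (simp add: g2_eq f2_eq)

lemma edom_lagr: "edom lagr2 = S"
proof -
  have "ereal z * f2 x \<noteq> -\<infinity>" for x using z not_MInf(1)[of x] by (cases "f2 x") auto
  then have "lagr2 x < \<infinity> \<longleftrightarrow> x \<in> S" for x
    by (cases "x \<in> S") (simp_all add: lagr2_eq g2_outside)
  then show ?thesis unfolding edom_def[of lagr2] by blast
qed

lemma strongly_convex_lagr: "strongly_convex \<eta> lagr1"
proof -
  have "convex_on UNIV (\<lambda>x. g1 x + z * (f1 x - l))"
  proof (intro convex_on_add convex_on_cmul convex_on_diff z)
    show "convex_on UNIV g1" "convex_on UNIV f1" using sbo by (simp_all add: sbo_problem_def)
    show "concave_on UNIV (\<lambda>x. l)" by (simp add: concave_on_const)
  qed
  from strongly_convex_add_quadratic[OF this, of \<eta> c] show ?thesis by (simp add: algebra_simps)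
qed

lemma econvex_lagr: "econvex lagr2"
proof -
  have nm: "ereal z * f2 x \<noteq> -\<infinity>" for x using z not_MInf(1)[of x] by (cases "f2 x") auto
  show ?thesis using sbo z not_MInf
  by (intro econvex_add econvex_cmult) (simp_all add: sbo_problem_def nm)
qed

lemma composite_lagr: "composite_problem f1 f2 g1 g2 lagr1 lagr2 (Lg + \<eta> + z * Lf)"
  unfolding composite_problem_def
proof (intro conjI)
  have nm: "ereal z * f2 x \<noteq> -\<infinity>" for x using z not_MInf(1)[of x] by (cases "f2 x") auto
  show "computable_smooth f1 g1 lagr1" unfolding computable_smooth_def
    using \<eta> z by (intro exI[of _ z] exI[of _ 1] exI[of _ \<eta>] exI[of _ c] exI[of _ "- z * l"] conjI)
      (auto simp: algebra_simps)
  show "computable_prox f2 g2 lagr2" using z by (auto simp: computable_prox_def)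
  show "convex_on UNIV lagr1"
    using strongly_convex_imp_convex_on[OF strongly_convex_lagr] \<eta> by auto
  show "lipschitz_gradient (Lg + \<eta> + z * Lf) lagr1"
    using sbo \<eta> z unfolding sbo_problem_def
    by (intro lipschitz_gradient_add lipschitz_gradient_cmult lipschitz_gradient_quadratic) auto
  show "0 < Lg + \<eta> + z * Lf" using \<eta> z Lf_pos Lg_ge_1 by (simp add: add_pos_nonneg)
  show "proper lagr2" unfolding proper_def edom_lagr using S_nonempty not_MInf nm by auto
  show "lsc lagr2" using sbo z not_MInf nm
    by (intro lsc_add lsc_cmult) (auto simp: sbo_problem_def)
  show "econvex lagr2" by (rule econvex_lagr)
qed

lemma approximately_stationary_lagr:
  assumes "x \<in> S" "y \<in> S" "subdiff (esum lagr1 lagr2) x \<noteq> {}"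
    and "infdist 0 (subdiff (esum lagr1 lagr2) x) \<le> \<epsilon>"
  shows "G x + \<eta> / 2 * (norm (x - c))\<^sup>2 + z * (F x - l) + \<eta> / 2 * (norm (y - x))\<^sup>2
    - \<epsilon> * norm (y - x) \<le> G y + \<eta> / 2 * (norm (y - c))\<^sup>2 + z * (F y - l)"
  using approximately_stationary[OF strongly_convex_lagr econvex_lagr
      lagr2_eq[OF assms(1)] lagr2_eq[OF assms(2)] assms(3,4)]
  by (simp add: algebra_simps)

end

end


section \<open>Estimates for the number of operations\<close>

text \<open>The logarithmic factor of the hidden constant, in which it is squared, and the cost of one
  round with tolerance \<open>\<Delta>\<close> up to logarithmic and constant factors.\<close>

definition log_factor :: "real \<Rightarrow> real \<Rightarrow> real \<Rightarrow> real \<Rightarrow> real" where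
  "log_factor D \<Omega> Lf Lg = 1 + ln (1 + D) + ln (1 + \<Omega>) + ln (1 + Lf) + ln (1 + Lg)"

definition round_weight :: "real \<Rightarrow> real \<Rightarrow> real \<Rightarrow> real \<Rightarrow> real \<Rightarrow> real" where
  "round_weight D \<Omega> Lf Lg \<Delta> = sqrt (C_D D * Lf * \<Omega>) / \<Delta> + sqrt (C_D D * Lg) / sqrt \<Delta>"

lemma nat_ceiling_log_le:
  fixes x y :: real
  assumes "0 < x" "x \<le> y" "1 \<le> y"
  shows "real (nat \<lceil>log 2 x\<rceil>) \<le> 1 + 3 / 2 * ln y"
proof -
  have "log 2 x \<le> log 2 y" using assms by simp
  also have "\<dots> = ln y / ln 2" by (simp add: log_def)
  also have "\<dots> \<le> ln y / (2 / 3)"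
    using assms ln2_ge_two_thirds by (intro divide_left_mono) auto
  finally have "log 2 x \<le> 3 / 2 * ln y" by simp
  moreover have "0 \<le> ln y" using assms by simp
  ultimately show ?thesis by linarith
qed

lemma le_two_power_nat_ceiling_log:
  fixes x :: real
  assumes "0 < x"
  shows "x \<le> 2 ^ nat \<lceil>log 2 x\<rceil>"
proof -
  have "x = 2 powr (log 2 x)" using assms by simp
  also have "\<dots> \<le> 2 powr real (nat \<lceil>log 2 x\<rceil>)" by (intro powr_mono) linarith+
  finally show ?thesis by (simp add: powr_realpow)
qed

text \<open>The parameters of one round: \<open>eta\<close> is the regularization parameter and \<open>del\<close> the accuracy
  passed to the dual routine.\<close>

context
  fixes D \<Omega> Lf Lg \<Delta> M :: real
  assumes D: "0 < D" and \<Omega>: "1 \<le> \<Omega>" and Lf: "0 < Lf" and Lg: "1 \<le> Lg"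
    and \<Delta>: "0 < \<Delta>" "\<Delta> \<le> 1" and M: "1 \<le> M" "M * \<Delta> \<le> \<Omega>"
begin

abbreviation "eta \<equiv> \<Delta> / C_D D"
abbreviation "del \<equiv> \<Delta> / (4 * C_D D * M)"
abbreviation "Lam \<equiv> log_factor D \<Omega> Lf Lg"
abbreviation "W \<equiv> round_weight D \<Omega> Lf Lg \<Delta>"

lemma C_D_bounds: "1 \<le> C_D D" "D \<le> C_D D" "D\<^sup>2 \<le> C_D D" "C_D D \<le> (1 + D)\<^sup>2"
  using D by (auto simp: C_D_def power2_eq_square algebra_simps)

lemma ln_parts_nonneg: "0 \<le> ln (1 + D)" "0 \<le> ln (1 + \<Omega>)" "0 \<le> ln (1 + Lf)" "0 \<le> ln (1 + Lg)"
  "0 \<le> ln (1 / \<Delta>)"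
  using D \<Omega> Lf Lg \<Delta> by auto

lemma log_factor_ge_1: "1 \<le> Lam"
  using ln_parts_nonneg by (simp add: log_factor_def)

lemma round_weight_ge_1: "1 \<le> W"
proof -
  have "\<Delta> \<le> C_D D * Lg" using C_D_bounds(1) Lg \<Delta> mult_mono[of 1 "C_D D" 1 Lg] by simp
  then have "1 \<le> sqrt (C_D D * Lg) / sqrt \<Delta>" using \<Delta> by simp
  moreover have "0 \<le> sqrt (C_D D * Lf * \<Omega>) / \<Delta>" using C_D_bounds Lf \<Omega> \<Delta> by auto
  ultimately show ?thesis unfolding round_weight_def by linarith
qed

lemma M_le: "M \<le> \<Omega> / \<Delta>"
  using M \<Delta> by (simp add: field_simps)

text \<open>The left-hand side is the square root of the condition number of the Lagrangian.\<close>

lemma sqrt_condition_le: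
  assumes "0 \<le> z" "z \<le> 2 * M"
  shows "sqrt ((Lg + eta + z * Lf) / eta) \<le> 2 * W"
proof (rule real_le_lsqrt)
  define p q where "p = sqrt (C_D D * Lf * \<Omega>) / \<Delta>" and "q = sqrt (C_D D * Lg) / sqrt \<Delta>"
  have pq: "0 \<le> p" "0 \<le> q" "p\<^sup>2 = C_D D * Lf * \<Omega> / \<Delta>\<^sup>2" "q\<^sup>2 = C_D D * Lg / \<Delta>"
    using C_D_bounds Lf \<Omega> Lg \<Delta> by (auto simp: p_def q_def power_divide)
  have W: "W = p + q" by (simp add: round_weight_def p_def q_def)
  show "0 \<le> 2 * W" using round_weight_ge_1 by simp
  have "z \<le> 2 * (\<Omega> / \<Delta>)" using assms M_le by linarith
  then have "z * (Lf * C_D D / \<Delta>) \<le> 2 * (\<Omega> / \<Delta>) * (Lf * C_D D / \<Delta>)"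
    using Lf C_D_bounds \<Delta> by (intro mult_right_mono) auto
  also have "\<dots> = 2 * p\<^sup>2" using pq by (simp add: power2_eq_square)
  finally have 1: "z * (Lf * C_D D / \<Delta>) \<le> 2 * p\<^sup>2" .
  have "\<Delta> \<le> C_D D * Lg" using C_D_bounds(1) Lg \<Delta> mult_mono[of 1 "C_D D" 1 Lg] by simp
  then have 2: "1 \<le> q\<^sup>2" using pq \<Delta> by simp
  have "(Lg + eta + z * Lf) / eta = C_D D * Lg / \<Delta> + 1 + z * (Lf * C_D D / \<Delta>)"
    using C_D_bounds(1) \<Delta> by (simp add: field_simps)
  also have "\<dots> \<le> 4 * p\<^sup>2 + 4 * q\<^sup>2" using 1 2 pq(4) zero_le_power2[of p] by linarith
  also have "\<dots> \<le> (2 * W)\<^sup>2"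
    using mult_nonneg_nonneg[OF pq(1,2)] by (simp add: W power2_eq_square algebra_simps)
  finally show "(Lg + eta + z * Lf) / eta \<le> (2 * W)\<^sup>2" .
qed

lemma inverse_power_bounds: "1 / del \<le> 4 * (1 + D)\<^sup>2 * (1 + \<Omega>) / \<Delta>\<^sup>2"
  "1 / eta \<le> (1 + D)\<^sup>2 / \<Delta>" "M \<le> (1 + \<Omega>) / \<Delta>"
proof -
  show M': "M \<le> (1 + \<Omega>) / \<Delta>" using M \<Delta> by (simp add: field_simps)
  have "1 / del = (4 * C_D D) * M / \<Delta>" using C_D_bounds \<Delta> M by (simp add: field_simps)
  also have "\<dots> \<le> (4 * (1 + D)\<^sup>2) * ((1 + \<Omega>) / \<Delta>) / \<Delta>"
    using C_D_bounds \<Delta> M M' by (intro divide_right_mono mult_mono) auto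
  finally show "1 / del \<le> 4 * (1 + D)\<^sup>2 * (1 + \<Omega>) / \<Delta>\<^sup>2" by (simp add: power2_eq_square)
  show "1 / eta \<le> (1 + D)\<^sup>2 / \<Delta>" using C_D_bounds \<Delta> by (simp add: divide_right_mono)
qed

lemma del_eta_pos: "0 < del" "0 < eta"
  using C_D_bounds \<Delta> M by auto

lemma log_accuracy_le:
  assumes "0 \<le> z" "z \<le> 2 * M"
  shows "1 + real (nat \<lceil>log 2 ((Lg + eta + z * Lf) * D / (eta * del\<^sup>2))\<rceil>)
    \<le> 11 * (Lam * (1 + ln (1 / \<Delta>)))"
proof -
  define a b c d e where "a = 1 + D" and "b = 1 + \<Omega>" and "c = 1 + Lf" and "d = 1 + Lg" and "e = 1 / \<Delta>"
  have pos: "1 \<le> a" "1 \<le> b" "1 \<le> c" "1 \<le> d" "1 \<le> e"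
    using D \<Omega> Lf Lg \<Delta> by (auto simp: a_def b_def c_def d_def e_def)
  \<comment> \<open>Every parameter is bounded by a monomial in \<open>a\<close>, \<open>b\<close>, \<open>c\<close>, \<open>d\<close>, \<open>e\<close>, all at least 1;
    \<open>y\<close> is the product of these bounds.\<close>
  define y where "y = 32 * a ^ 7 * b ^ 3 * c * d * e ^ 6"
  have inv: "1 / del \<le> 4 * a\<^sup>2 * b * e\<^sup>2" "1 / eta \<le> a\<^sup>2 * e" "M \<le> b * e"
    using inverse_power_bounds by (simp_all add: a_def b_def e_def power_divide)
  define p q where "p = 1 / del" and "q = 1 / eta"
  have pq: "0 \<le> p" "0 \<le> q" "p \<le> 4 * a\<^sup>2 * b * e\<^sup>2" "q \<le> a\<^sup>2 * e"
    using inv C_D_bounds(1) M \<Delta> unfolding p_def q_def by simp_all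
  have eta1: "eta \<le> 1" using C_D_bounds \<Delta> by simp
  have be: "1 \<le> b * e" using pos mult_mono[of 1 b 1 e] by simp
  have 1: "1 \<le> 2 * (b * e)" and 2: "0 \<le> (2 * (b * e)) * Lf" using be Lf by (auto simp: mult_nonneg_nonneg)
  have "Lg + eta + z * Lf \<le> d + (2 * (b * e)) * Lf"
    using assms inv eta1 Lf by (auto intro!: add_mono mult_right_mono simp: d_def)
  also have "\<dots> \<le> d * (2 * (b * e)) + d * ((2 * (b * e)) * Lf)"
    using mult_left_mono[OF 1, of d] mult_right_mono[OF pos(4) 2] pos by linarith
  also have "\<dots> = 2 * (b * e) * c * d" by (simp add: c_def algebra_simps)
  finally have L: "Lg + eta + z * Lf \<le> 2 * (b * e) * c * d" .
  have L0: "0 < Lg + eta + z * Lf" using Lg del_eta_pos assms Lf by (simp add: add_pos_nonneg)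
  have "(Lg + eta + z * Lf) * D / (eta * del\<^sup>2) = (Lg + eta + z * Lf) * D * (1 / eta) * (1 / del)\<^sup>2"
    by (simp add: power_divide)
  also have "\<dots> = (Lg + eta + z * Lf) * D * q * p\<^sup>2" by (simp add: p_def q_def)
  also have "\<dots> \<le> (2 * (b * e) * c * d) * a * (a\<^sup>2 * e) * (4 * a\<^sup>2 * b * e\<^sup>2)\<^sup>2"
    using L L0 pq pos D
    by (intro mult_mono power_mono) (auto simp: a_def intro!: mult_nonneg_nonneg)
  also have "\<dots> = y" unfolding y_def by algebra
  finally have le: "(Lg + eta + z * Lf) * D / (eta * del\<^sup>2) \<le> y" .
  have y1: "1 \<le> y"
  proof -
    have "1 * 1 * 1 * 1 * 1 * 1 \<le> y" unfolding y_def
      using pos by (intro mult_mono one_le_power) auto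
    then show ?thesis by simp
  qed
  have "ln y = 5 * ln 2 + 7 * ln a + 3 * ln b + ln c + ln d + 6 * ln e"
  proof -
    have "ln (32::real) = 5 * ln 2" using ln_realpow[of 2 5] by simp
    then show ?thesis using pos by (simp add: y_def ln_mult ln_realpow)
  qed
  then have lny: "ln y \<le> 5 + 7 * ln a + 3 * ln b + ln c + ln d + 6 * ln e"
    using ln2_le_25_over_36 by linarith
  have "real (nat \<lceil>log 2 ((Lg + eta + z * Lf) * D / (eta * del\<^sup>2))\<rceil>) \<le> 1 + 3 / 2 * ln y"
    by (intro nat_ceiling_log_le[OF _ le y1] divide_pos_pos mult_pos_pos zero_less_power
        L0 D del_eta_pos)
  moreover have "Lam = 1 + ln a + ln b + ln c + ln d"
    by (simp add: log_factor_def a_def b_def c_def d_def)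
  moreover have "0 \<le> ln a" "0 \<le> ln b" "0 \<le> ln c" "0 \<le> ln d" "0 \<le> ln e" using pos by auto
  moreover have "ln e \<le> Lam * ln e"
    using log_factor_ge_1 \<open>0 \<le> ln e\<close> by (simp add: mult_le_cancel_right1)
  ultimately show ?thesis using lny unfolding e_def[symmetric] distrib_left by linarith
qed

lemma number_of_calls_le:
  "real (2 + nat \<lceil>log 2 M\<rceil> + nat \<lceil>log 2 (2 * M / (eta * del ^ 3))\<rceil>)
    \<le> 14 * (Lam * (1 + ln (1 / \<Delta>)))"
proof -
  define a b e where "a = 1 + D" and "b = 1 + \<Omega>" and "e = 1 / \<Delta>"
  have pos: "1 \<le> a" "1 \<le> b" "1 \<le> e"
    using D \<Omega> \<Delta> by (auto simp: a_def b_def e_def)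
  define y where "y = 128 * a ^ 8 * b ^ 4 * e ^ 8"
  have inv: "1 / del \<le> 4 * a\<^sup>2 * b * e\<^sup>2" "1 / eta \<le> a\<^sup>2 * e" "M \<le> b * e"
    using inverse_power_bounds by (simp_all add: a_def b_def e_def power_divide)
  define p q where "p = 1 / del" and "q = 1 / eta"
  have pq: "0 \<le> p" "0 \<le> q" "p \<le> 4 * a\<^sup>2 * b * e\<^sup>2" "q \<le> a\<^sup>2 * e"
    using inv C_D_bounds(1) M \<Delta> unfolding p_def q_def by simp_all
  have be: "1 \<le> b * e" using pos mult_mono[of 1 b 1 e] by simp
  have "2 * M / (eta * del ^ 3) = (2 * M) * (1 / eta) * (1 / del) ^ 3"
    by (simp add: power_divide)
  also have "\<dots> = (2 * M) * q * p ^ 3" by (simp add: p_def q_def)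
  also have "\<dots> \<le> (2 * (b * e)) * (a\<^sup>2 * e) * (4 * a\<^sup>2 * b * e\<^sup>2) ^ 3"
    using pq pos M inv(3) by (intro mult_mono power_mono) (auto intro!: mult_nonneg_nonneg)
  also have "\<dots> = y" unfolding y_def by algebra
  finally have le: "2 * M / (eta * del ^ 3) \<le> y" .
  have y1: "1 \<le> y"
  proof -
    have "1 * 1 * 1 * 1 \<le> y" unfolding y_def
      using pos by (intro mult_mono one_le_power) auto
    then show ?thesis by simp
  qed
  have "ln y = 7 * ln 2 + 8 * ln a + 4 * ln b + 8 * ln e"
  proof -
    have "ln (128::real) = 7 * ln 2" using ln_realpow[of 2 7] by simp
    then show ?thesis using pos by (simp add: y_def ln_mult ln_realpow)
  qed
  then have lny: "ln y \<le> 5 + 8 * ln a + 4 * ln b + 8 * ln e"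
    using ln2_le_25_over_36 by linarith
  have "real (nat \<lceil>log 2 (2 * M / (eta * del ^ 3))\<rceil>) \<le> 1 + 3 / 2 * ln y"
    by (intro nat_ceiling_log_le[OF _ le y1] divide_pos_pos mult_pos_pos zero_less_power
        del_eta_pos) (use M in auto)
  moreover have "real (nat \<lceil>log 2 M\<rceil>) \<le> 1 + 3 / 2 * ln (b * e)"
    using M inv be by (intro nat_ceiling_log_le) auto
  moreover have "ln (b * e) = ln b + ln e" using pos by (simp add: ln_mult)
  moreover have "Lam = 1 + ln a + ln b + ln (1 + Lf) + ln (1 + Lg)"
    by (simp add: log_factor_def a_def b_def)
  moreover have "0 \<le> ln a" "0 \<le> ln b" "0 \<le> ln (1 + Lf)" "0 \<le> ln (1 + Lg)" "0 \<le> ln e"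
    using pos ln_parts_nonneg by auto
  moreover have "ln e \<le> Lam * ln e"
    using log_factor_ge_1 \<open>0 \<le> ln e\<close> by (simp add: mult_le_cancel_right1)
  ultimately show ?thesis using lny unfolding e_def[symmetric] distrib_left of_nat_add by linarith
qed

lemma apg0_cost_le:
  "D * sqrt (Lf / \<Delta>) \<le> sqrt (C_D D * Lf * \<Omega>) / \<Delta>" "D * sqrt (Lg / \<Delta>) \<le> sqrt (C_D D * Lg) / sqrt \<Delta>"
proof -
  have d: "D \<le> sqrt (C_D D)" using C_D_bounds(3) real_le_rsqrt by blast
  show "D * sqrt (Lg / \<Delta>) \<le> sqrt (C_D D * Lg) / sqrt \<Delta>"
    using d Lg \<Delta> by (auto simp: real_sqrt_divide real_sqrt_mult intro!: divide_right_mono mult_right_mono)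
  have "D * sqrt (Lf / \<Delta>) \<le> sqrt (C_D D) * sqrt (Lf * \<Omega> / \<Delta>\<^sup>2)"
  proof (intro mult_mono real_sqrt_le_mono)
    have "Lf * \<Delta> \<le> Lf * \<Omega>" using Lf \<Delta> \<Omega> by (intro mult_left_mono) auto
    then show "Lf / \<Delta> \<le> Lf * \<Omega> / \<Delta>\<^sup>2" using \<Delta> by (simp add: field_simps power2_eq_square)
  qed (use d D Lf \<Delta> C_D_bounds in auto)
  also have "\<dots> = sqrt (C_D D * Lf * \<Omega>) / \<Delta>" using \<Delta> by (simp add: real_sqrt_divide real_sqrt_mult)
  finally show "D * sqrt (Lf / \<Delta>) \<le> sqrt (C_D D * Lf * \<Omega>) / \<Delta>" .
qed

end


section \<open>One round of the initialization\<close>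

text \<open>The bilevel problem together with the two black-box subroutines.\<close>

locale bilevel_apg = bilevel f1 g1 f2 g2 Lf Lg D
  for f1 g1 :: "'a::euclidean_space \<Rightarrow> real" and f2 g2 :: "'a \<Rightarrow> ereal" and Lf Lg D :: real +
  fixes apg0 :: "'a apg0" and apgmu :: "'a apgmu" and K0 K\<mu> Bf :: real and \<kappa> :: nat
  assumes K0: "0 \<le> K0" and apg0: "apg0_spec K0 \<kappa> f1 f2 g1 g2 apg0"
    and K\<mu>: "0 \<le> K\<mu>" and apgmu: "apgmu_spec K\<mu> \<kappa> f1 f2 g1 g2 apgmu"
    and Bf: "1 \<le> Bf" and lipschitz_f: "Bf-lipschitz_on (edom g2) (\<lambda>x. real_of_ereal (esum f1 f2 x))"
begin

lemma F_diff_le: "x \<in> S \<Longrightarrow> y \<in> S \<Longrightarrow> F x - F y \<le> Bf * norm (x - y)"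
  using lipschitz_onD[OF lipschitz_f, of x y] unfolding F_def[symmetric] dist_norm by simp

lemma infdist_argmin_le:
  assumes "x \<in> S" "T \<subseteq> S" "T \<noteq> {}"
  shows "infdist x T \<le> D"
proof -
  obtain y where "y \<in> T" using assms by blast
  then show ?thesis using infdist_le[of y T x] norm_diff_le_D[of x y] assms by (auto simp: dist_norm)
qed

lemma apg0_f:
  assumes "0 < \<Delta>" "x \<in> S" "apg0 f1 (\<lambda>x. f2 x + indic S x) Lf \<Delta> x D = (y, k)"
  shows "y \<in> S" "F y \<le> fs + \<Delta>" "real k \<le> \<kappa> * (K0 * (1 + D * sqrt (Lf / \<Delta>)))"
proof -
  let ?h = "esum f1 (\<lambda>x. f2 x + indic S x)"
  have h: "?h x = ereal (F x)" if "x \<in> S" for x using that by (simp add: esum_def f2_eq indic_def)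
  have h_out: "?h x = \<infinity>" if "x \<notin> S" for x using that not_MInf by (simp add: esum_def indic_def)
  obtain x0 where x0: "x0 \<in> S" "F x0 = fs" using f_star_attained by blast
  have "\<not> ?h y < ?h x0" for y
    using x0 f_star_le[of y] by (cases "y \<in> S") (auto simp: h h_out)
  then have ne: "argmin ?h \<noteq> {}" by (auto simp: argmin_def is_arg_min_def)
  have "argmin ?h \<subseteq> S"
  proof
    fix y assume "y \<in> argmin ?h"
    then have "\<not> ?h x0 < ?h y" by (auto simp: argmin_def is_arg_min_def)
    then show "y \<in> S" using x0 by (cases "y \<in> S") (auto simp: h h_out)
  qed
  then have "infdist x (argmin ?h) \<le> D" using infdist_argmin_le assms(2) ne by blast
  then have *: "y \<in> edom (\<lambda>x. f2 x + indic S x)" "?h y \<le> (INF z. ?h z) + ereal \<Delta>"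
    "\<exists>pg. real pg \<le> K0 * (1 + D * sqrt (Lf / \<Delta>)) \<and> k \<le> \<kappa> * pg"
    using apg0 composite_f ne assms unfolding apg0_spec_def by blast+
  show y: "y \<in> S" using *(1) edom_f by simp
  have "?h y \<le> ?h x0 + ereal \<Delta>"
    using *(2) INF_lower[of x0 UNIV ?h] by (meson UNIV_I add_right_mono order_trans)
  then show "F y \<le> fs + \<Delta>" using y x0 by (simp add: h)
  show "real k \<le> \<kappa> * (K0 * (1 + D * sqrt (Lf / \<Delta>)))"
    using *(3) by (metis (no_types, lifting) mult_left_mono of_nat_0_le_iff of_nat_le_iff of_nat_mult order_trans)
qed

lemma apg0_g:
  assumes "0 < \<Delta>" "x \<in> S" "apg0 g1 g2 Lg \<Delta> x D = (y, k)"
  shows "y \<in> S" "G y \<le> gs + \<Delta>" "real k \<le> \<kappa> * (K0 * (1 + D * sqrt (Lg / \<Delta>)))"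
proof -
  let ?h = "esum g1 g2"
  obtain x0 where x0: "x0 \<in> S" "G x0 = gs" using g_star_attained by blast
  then have ne: "argmin ?h \<noteq> {}" "argmin ?h \<subseteq> S" by (auto simp: argmin_g)
  then have "infdist x (argmin ?h) \<le> D" using infdist_argmin_le assms(2) by blast
  then have *: "y \<in> S" "?h y \<le> (INF z. ?h z) + ereal \<Delta>"
    "\<exists>pg. real pg \<le> K0 * (1 + D * sqrt (Lg / \<Delta>)) \<and> k \<le> \<kappa> * pg"
    using apg0 composite_g ne(1) assms unfolding apg0_spec_def by blast+
  show y: "y \<in> S" by (rule *(1))
  have "?h y \<le> ?h x0 + ereal \<Delta>"
    using *(2) INF_lower[of x0 UNIV ?h] by (meson UNIV_I add_right_mono order_trans)
  then show "G y \<le> gs + \<Delta>" using y x0 by (simp add: esum_g)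
  show "real k \<le> \<kappa> * (K0 * (1 + D * sqrt (Lg / \<Delta>)))"
    using *(3) by (metis (no_types, lifting) mult_left_mono of_nat_0_le_iff of_nat_le_iff of_nat_mult order_trans)
qed

text \<open>The data of one round after the two calls of \<open>apg0\<close>; \<open>A\<close> is the oracle of the dual
  routine.\<close>

context
  fixes \<Delta> M l \<eta> \<delta> :: real and xf xg x_init :: 'a and A :: "real \<Rightarrow> 'a \<times> nat"
  assumes \<Delta>: "0 < \<Delta>" "\<Delta> \<le> 1 / Bf" and xf: "xf \<in> S" "F xf \<le> fs + \<Delta>"
    and xg: "xg \<in> S" "G xg \<le> gs + \<Delta>" and x_init: "x_init \<in> S"
    and l: "l = F xf + \<Delta>" and M: "M = max ((G xf - G xg + 1) / \<Delta>) 1"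
    and \<eta>: "\<eta> = \<Delta> / C_D D" and \<delta>: "\<delta> = \<Delta> / (4 * C_D D * M)"
    and A: "A = lagrangian_oracle apgmu (\<lambda>y. g1 y + \<eta> / 2 * (norm (y - xf))\<^sup>2) g2 \<eta> (Lg + \<eta>)
      (\<lambda>y. f1 y - l) f2 Lf x_init \<delta>"
begin

abbreviation "X z \<equiv> fst (A z)"

lemma Delta_le_1: "\<Delta> \<le> 1"
proof -
  have "1 / Bf \<le> 1" using Bf by simp
  then show ?thesis using \<Delta>(2) by linarith
qed

lemma M_bounds: "1 \<le> M" "M * \<Delta> \<le> \<Omega>" "G xf - gs \<le> M * \<Delta>"
proof -
  show "1 \<le> M" by (simp add: M)
  have "(G xf - G xg + 1) / \<Delta> \<le> M" by (simp add: M)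
  then have "G xf - G xg + 1 \<le> M * \<Delta>" using \<Delta> by (simp add: field_simps)
  then show "G xf - gs \<le> M * \<Delta>" using xg Delta_le_1 by linarith
  have "G xf - G xg + 1 \<le> \<Omega>" using G_le_Omega[OF xf(1)] g_star_le[OF xg(1)] by linarith
  then have "(G xf - G xg + 1) / \<Delta> * \<Delta> \<le> \<Omega>" using \<Delta> by simp
  moreover have "1 * \<Delta> \<le> \<Omega>" using Delta_le_1 Omega_ge_1 by simp
  ultimately show "M * \<Delta> \<le> \<Omega>" unfolding M by (simp add: max_def)
qed

lemmas param_bounds = D_pos Omega_ge_1 Lf_pos Lg_ge_1 \<Delta>(1) Delta_le_1 M_bounds(1,2)

lemma C_D_ge: "1 \<le> C_D D" "D \<le> C_D D"
  using C_D_bounds[OF param_bounds] by auto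

lemma eta_pos: "0 < \<eta>" and delta_pos: "0 < \<delta>"
  using del_eta_pos[OF param_bounds] by (auto simp: \<eta> \<delta>)

lemma M_delta: "M * \<delta> = \<eta> / 4"
  using M_bounds(1) C_D_ge by (simp add: \<eta> \<delta> field_simps)

text \<open>The last bound on the accuracy is used at multipliers above \<open>M\<close>, and the second, which
  rests on \<open>\<Delta> \<le> 1/Bf\<close>, at the end of the bisection.\<close>

lemma delta_le: "\<delta> \<le> \<Delta> / 4" "\<delta> * Bf \<le> 1 / 4" "\<delta>\<^sup>2 \<le> 1 / 16" "\<delta>\<^sup>2 * D \<le> 1 / 16"
proof -
  have 1: "1 * 1 \<le> C_D D * M" using C_D_ge M_bounds by (intro mult_mono) auto
  then show d: "\<delta> \<le> \<Delta> / 4" unfolding \<delta> using \<Delta> by (intro frac_le) auto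
  have "\<Delta> * Bf \<le> 1" using \<Delta> Bf by (simp add: field_simps)
  moreover have "\<delta> * Bf \<le> \<Delta> / 4 * Bf" using d Bf by (intro mult_right_mono) auto
  ultimately show "\<delta> * Bf \<le> 1 / 4" by linarith
  have d4: "\<delta> \<le> 1 / 4" using d Delta_le_1 by simp
  have "\<delta>\<^sup>2 \<le> (1 / 4)\<^sup>2" using d4 delta_pos by (intro power_mono) auto
  then show "\<delta>\<^sup>2 \<le> 1 / 16" by (simp add: power2_eq_square)
  have "D * 1 \<le> C_D D * M" using C_D_ge M_bounds D_pos by (intro mult_mono) auto
  then have "\<Delta> * D \<le> 1 * (C_D D * M)" using Delta_le_1 \<Delta> D_pos by (intro mult_mono) auto
  then have "\<delta> * D \<le> 1 / 4" unfolding \<delta> using C_D_ge M_bounds by (simp add: field_simps)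
  then have "\<delta> * (\<delta> * D) \<le> 1 / 4 * (1 / 4)" using d4 delta_pos D_pos by (intro mult_mono) auto
  then show "\<delta>\<^sup>2 * D \<le> 1 / 16" by (simp add: power2_eq_square)
qed

lemma eta_C_D: "\<eta> * (1 + D * (1 + D)) = \<Delta>"
  using C_D_ge(1) by (simp add: \<eta> C_D_def[symmetric])

lemma oracle_spec:
  assumes "0 \<le> z"
  shows "X z \<in> S"
    and "y \<in> S \<Longrightarrow> G (X z) + \<eta> / 2 * (norm (X z - xf))\<^sup>2 + z * (F (X z) - l)
      + \<eta> / 2 * (norm (y - X z))\<^sup>2 - \<eta> * \<delta>\<^sup>2 * norm (y - X z)
      \<le> G y + \<eta> / 2 * (norm (y - xf))\<^sup>2 + z * (F y - l)"
    and "real (snd (A z)) \<le> 2 + \<kappa> * (K\<mu> * (sqrt ((Lg + \<eta> + z * Lf) / \<eta>) *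
      (1 + real (nat \<lceil>log 2 ((Lg + \<eta> + z * Lf) * D / (\<eta> * \<delta>\<^sup>2))\<rceil>))))"
proof -
  let ?p1 = "\<lambda>x. (g1 x + \<eta> / 2 * (norm (x - xf))\<^sup>2) + z * (f1 x - l)"
  let ?p2 = "\<lambda>x. g2 x + ereal z * f2 x"
  obtain x k where xk: "apgmu \<eta> ?p1 ?p2 (Lg + \<eta> + z * Lf) (\<eta> * \<delta>\<^sup>2) x_init = (x, k)"
    by fastforce
  then have Az: "A z = (x, k + 2)" by (simp add: A lagrangian_oracle_def)
  have acc: "0 < \<eta> * \<delta>\<^sup>2" using eta_pos delta_pos by simp
  have dom: "edom ?p2 = S" by (rule edom_lagr[OF eta_pos assms])
  have bdd: "bounded (edom ?p2)" "diameter (edom ?p2) \<le> D" "x_init \<in> edom ?p2"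
    unfolding dom using S_compact compact_imp_bounded diam x_init by auto
  have *: "x \<in> edom ?p2 \<and> subdiff (esum ?p1 ?p2) x \<noteq> {} \<and> infdist 0 (subdiff (esum ?p1 ?p2) x) \<le> \<eta> * \<delta>\<^sup>2 \<and>
    (\<exists>pg. real pg \<le> K\<mu> * (sqrt ((Lg + \<eta> + z * Lf) / \<eta>) *
      (1 + real (nat \<lceil>log 2 ((Lg + \<eta> + z * Lf) * D / (\<eta> * \<delta>\<^sup>2))\<rceil>))) \<and> k \<le> \<kappa> * pg)"
    by (rule apgmu[unfolded apgmu_spec_def, rule_format, OF composite_lagr[OF eta_pos assms] eta_pos
          strongly_convex_lagr[OF eta_pos assms] acc bdd xk])
  then show "X z \<in> S" using dom by (simp add: Az)
  show "y \<in> S \<Longrightarrow> G (X z) + \<eta> / 2 * (norm (X z - xf))\<^sup>2 + z * (F (X z) - l)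
      + \<eta> / 2 * (norm (y - X z))\<^sup>2 - \<eta> * \<delta>\<^sup>2 * norm (y - X z)
      \<le> G y + \<eta> / 2 * (norm (y - xf))\<^sup>2 + z * (F y - l)"
    using approximately_stationary_lagr[OF eta_pos assms, of x y xf l "\<eta> * \<delta>\<^sup>2"] * dom by (simp add: Az)
  obtain pg where pg: "real pg \<le> K\<mu> * (sqrt ((Lg + \<eta> + z * Lf) / \<eta>) *
      (1 + real (nat \<lceil>log 2 ((Lg + \<eta> + z * Lf) * D / (\<eta> * \<delta>\<^sup>2))\<rceil>)))" "k \<le> \<kappa> * pg"
    using * by blast
  have "real k \<le> \<kappa> * real pg" using pg(2) by (metis of_nat_le_iff of_nat_mult)
  also have "\<dots> \<le> \<kappa> * (K\<mu> * (sqrt ((Lg + \<eta> + z * Lf) / \<eta>) *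
      (1 + real (nat \<lceil>log 2 ((Lg + \<eta> + z * Lf) * D / (\<eta> * \<delta>\<^sup>2))\<rceil>))))"
    using pg(1) by (intro mult_left_mono) auto
  finally show "real (snd (A z)) \<le> 2 + \<kappa> * (K\<mu> * (sqrt ((Lg + \<eta> + z * Lf) / \<eta>) *
      (1 + real (nat \<lceil>log 2 ((Lg + \<eta> + z * Lf) * D / (\<eta> * \<delta>\<^sup>2))\<rceil>))))"
    by (simp add: Az)
qed

text \<open>Comparison with \<open>xf\<close>, which satisfies the constraint with slack \<open>\<Delta>\<close>: multipliers above
  \<open>M\<close> penalize infeasibility enough.\<close>

lemma oracle_feasible:
  assumes "M \<le> z"
  shows "F (X z) - l \<le> \<delta>"
proof (rule ccontr)
  assume neg: "\<not> F (X z) - l \<le> \<delta>"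
  have z: "0 \<le> z" "0 < z" using assms M_bounds(1) by auto
  note X = oracle_spec(1)[OF z(1)]
  have "G (X z) + z * (F (X z) - l) - \<eta> * \<delta>\<^sup>2 * norm (xf - X z) \<le> G xf - z * \<Delta>"
    using oracle_spec(2)[OF z(1) xf(1)] eta_pos
    by (simp add: l) (smt (verit) divide_nonneg_nonneg mult_nonneg_nonneg zero_le_power2)
  moreover have "\<eta> * \<delta>\<^sup>2 * norm (xf - X z) \<le> \<eta> * (\<delta>\<^sup>2 * D)"
    using norm_diff_le_D[OF xf(1) X] eta_pos by (simp add: mult.assoc mult_left_mono)
  moreover have "\<eta> * (\<delta>\<^sup>2 * D) \<le> \<eta> * (1 / 16)" using delta_le(4) eta_pos by (intro mult_left_mono) auto
  moreover have "M * \<delta> \<le> z * (F (X z) - l)" using neg assms z delta_pos by (intro mult_mono) auto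
  moreover have "M * \<Delta> \<le> z * \<Delta>" using assms \<Delta> by (intro mult_right_mono) auto
  ultimately show False using M_delta M_bounds(3) g_star_le[OF X] eta_pos by linarith
qed

text \<open>Strong convexity makes the approximate Lagrangian minimizers nearly Lipschitz in the
  multiplier. If the bisection ended with a short interval, its end points would therefore give
  nearly equal values of \<open>f\<close>, although these differ by more than \<open>3\<delta>\<close>.\<close>

lemma oracle_gap:
  assumes ab: "0 \<le> a" "a < b" "b \<le> 2 * M" and "\<delta> < F (X a) - l" "F (X b) - l \<le> \<delta>"
    and nc: "\<not> \<bar>b * (F (X b) - l)\<bar> \<le> 4 * M * \<delta>"
  shows "\<eta> * \<delta> ^ 3 < b - a"
proof (rule ccontr)
  assume "\<not> \<eta> * \<delta> ^ 3 < b - a"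
  then have short: "b - a \<le> \<eta> * \<delta> ^ 3" by simp
  have b: "0 \<le> b" "0 < b" using ab by auto
  define r where "r = norm (X a - X b)"
  note Xa = oracle_spec(1)[OF ab(1)] and Xb = oracle_spec(1)[OF b(1)]
  have Md: "0 < M * \<delta>" using M_bounds(1) delta_pos by simp
  \<comment> \<open>Complementarity can only fail because the constraint holds with a margin at the point for \<open>b\<close>.\<close>
  have "b * (F (X b) - l) \<le> 2 * M * \<delta>"
  proof -
    have "b * (F (X b) - l) \<le> b * \<delta>" using assms b by (intro mult_left_mono) auto
    also have "\<dots> \<le> 2 * M * \<delta>" using ab delta_pos by (intro mult_right_mono) auto
    finally show ?thesis .
  qed
  then have v: "b * (F (X b) - l) < - (4 * M * \<delta>)" using nc Md by (simp add: abs_if split: if_splits)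
  have "F (X b) - l < - (2 * \<delta>)"
  proof (rule ccontr)
    assume "\<not> F (X b) - l < - (2 * \<delta>)"
    then have "b * (- (2 * \<delta>)) \<le> b * (F (X b) - l)" using b by (intro mult_left_mono) auto
    moreover have "b * (2 * \<delta>) \<le> 2 * M * (2 * \<delta>)" using ab delta_pos by (intro mult_right_mono) auto
    ultimately show False using v by simp
  qed
  then have drop: "3 * \<delta> < F (X a) - F (X b)" using assms by linarith
  have lip: "F (X a) - F (X b) \<le> Bf * r" using F_diff_le[OF Xa Xb] by (simp add: r_def)
  have r: "0 \<le> r" by (simp add: r_def)
  \<comment> \<open>Add the near-optimality of the point at \<open>a\<close> against that at \<open>b\<close> and vice versa.\<close>
  have "\<eta> * r\<^sup>2 - 2 * (\<eta> * \<delta>\<^sup>2 * r) \<le> (b - a) * (F (X a) - F (X b))"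
    using oracle_spec(2)[OF ab(1) Xb] oracle_spec(2)[OF b(1) Xa]
    by (simp add: r_def norm_minus_commute[of "X b" "X a"] algebra_simps)
  also have "\<dots> \<le> (\<eta> * \<delta> ^ 3) * (Bf * r)"
    using short lip drop delta_pos ab eta_pos by (intro mult_mono) auto
  also have "\<dots> = (\<eta> * \<delta>\<^sup>2 * r) * (\<delta> * Bf)" by (simp add: power2_eq_square power3_eq_cube)
  also have "\<dots> \<le> (\<eta> * \<delta>\<^sup>2 * r) * (1 / 4)"
    using delta_le(2) eta_pos r by (intro mult_left_mono) auto
  finally have "\<eta> * r * r \<le> \<eta> * r * (9 / 4 * \<delta>\<^sup>2)" by (simp add: power2_eq_square algebra_simps)
  moreover have "0 < r" using lip drop delta_pos r Bf by (cases "r = 0") auto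
  ultimately have "r \<le> 9 / 4 * \<delta>\<^sup>2" using eta_pos by simp
  then have "Bf * r \<le> Bf * (9 / 4 * \<delta>\<^sup>2)" using Bf by (intro mult_left_mono) auto
  also have "\<dots> = 9 / 4 * \<delta> * (\<delta> * Bf)" by (simp add: power2_eq_square)
  also have "\<dots> \<le> 9 / 4 * \<delta> * (1 / 4)" using delta_le(2) delta_pos by (intro mult_left_mono) auto
  finally show False using lip drop delta_pos by linarith
qed

text \<open>Comparison with a solution of the bilevel problem, which satisfies the constraint if
  \<open>p\<^sup>* \<le> l\<close>. The regularization, the complementarity error and the stationarity error contribute
  \<open>\<eta> D\<^sup>2/2\<close>, \<open>\<eta>\<close> and \<open>\<eta> D/16\<close>, and the constant \<open>C_D\<close> is what makes their sum at most
  \<open>\<Delta>\<close>.\<close>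

lemma oracle_optimal:
  assumes "0 \<le> z" "\<bar>z * (F (X z) - l)\<bar> \<le> 4 * M * \<delta>" "ps \<le> l"
  shows "G (X z) - G xg \<le> \<Delta>"
proof -
  obtain y where y: "y \<in> S" "G y = gs" "F y = ps" using p_star_attained by blast
  note X = oracle_spec(1)[OF assms(1)]
  have "(norm (y - xf))\<^sup>2 \<le> D\<^sup>2" using norm_diff_le_D[OF y(1) xf(1)] by (intro power_mono) auto
  then have 1: "\<eta> / 2 * (norm (y - xf))\<^sup>2 \<le> \<eta> / 2 * D\<^sup>2" using eta_pos by (intro mult_left_mono) auto
  have 2: "\<eta> * \<delta>\<^sup>2 * norm (y - X z) \<le> \<eta> * (1 / 16) * D"
    using norm_diff_le_D[OF y(1) X] delta_le(3) eta_pos by (intro mult_mono) auto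
  have 3: "z * (F y - l) \<le> 0" using assms y by (intro mult_nonneg_nonpos) auto
  have 4: "- (z * (F (X z) - l)) \<le> \<eta>" using assms(2) M_delta by simp
  have "0 \<le> \<eta> / 2 * (norm (X z - xf))\<^sup>2" "0 \<le> \<eta> / 2 * (norm (y - X z))\<^sup>2" using eta_pos by auto
  then have "G (X z) \<le> gs + \<eta> / 2 * D\<^sup>2 + \<eta> * (1 / 16) * D + \<eta>"
    using oracle_spec(2)[OF assms(1) y(1)] y(2) 1 2 3 4 by linarith
  moreover have "0 \<le> \<eta> * D\<^sup>2" "0 \<le> \<eta> * D" using eta_pos D_pos by auto
  then have "\<eta> / 2 * D\<^sup>2 + \<eta> * (1 / 16) * D + \<eta> \<le> \<eta> * (1 + D * (1 + D))"
    by (simp add: algebra_simps power2_eq_square)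
  ultimately show ?thesis using eta_C_D g_star_le[OF xg(1)] by linarith
qed

abbreviation "H \<equiv> log_factor D \<Omega> Lf Lg * (1 + ln (1 / \<Delta>))"
abbreviation "Wr \<equiv> round_weight D \<Omega> Lf Lg \<Delta>"

lemma H_ge_1: "1 \<le> H"
proof -
  have "1 * 1 \<le> H"
    using log_factor_ge_1[OF param_bounds] ln_parts_nonneg[OF param_bounds] by (intro mult_mono) auto
  then show ?thesis by simp
qed

lemma oracle_cost:
  assumes "0 \<le> z" "z \<le> 2 * M"
  shows "real (snd (A z)) \<le> 22 * (1 + \<kappa> * K\<mu>) * (Wr * H)"
proof -
  have "sqrt ((Lg + \<eta> + z * Lf) / \<eta>) *
      (1 + real (nat \<lceil>log 2 ((Lg + \<eta> + z * Lf) * D / (\<eta> * \<delta>\<^sup>2))\<rceil>)) \<le> (2 * Wr) * (11 * H)"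
    unfolding \<eta> \<delta>
    using round_weight_ge_1[OF param_bounds] sqrt_condition_le[OF param_bounds assms]
      log_accuracy_le[OF param_bounds assms] by (intro mult_mono) auto
  then have "\<kappa> * (K\<mu> * (sqrt ((Lg + \<eta> + z * Lf) / \<eta>) *
      (1 + real (nat \<lceil>log 2 ((Lg + \<eta> + z * Lf) * D / (\<eta> * \<delta>\<^sup>2))\<rceil>)))) \<le> \<kappa> * (K\<mu> * ((2 * Wr) * (11 * H)))"
    using K\<mu> by (intro mult_left_mono) auto
  moreover have "1 * 1 \<le> Wr * H"
    using round_weight_ge_1[OF param_bounds] H_ge_1 by (intro mult_mono) auto
  ultimately show ?thesis using oracle_spec(3)[OF assms(1)] by (simp add: algebra_simps)
qed

lemma dual_round:
  "\<exists>x z n. dual apgmu (\<lambda>y. g1 y + \<eta> / 2 * (norm (y - xf))\<^sup>2) g2 \<eta> (Lg + \<eta>) (\<lambda>y. f1 y - l) f2 Lf 1 M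
      x_init \<delta> = Some ((x, z), n) \<and>
    x \<in> S \<and> F x \<le> l + \<delta> \<and> (ps \<le> l \<longrightarrow> G x - G xg \<le> \<Delta>) \<and>
    real n \<le> 308 * (1 + \<kappa> * K\<mu>) * (Wr * H\<^sup>2)"
proof -
  define \<psi> where "\<psi> = esum (\<lambda>y. f1 y - l) f2"
  have \<psi>: "\<psi> x = ereal (F x - l)" if "x \<in> S" for x using that by (simp add: \<psi>_def esum_def f2_eq)
  have le: "max 0 (\<psi> x) \<le> ereal \<delta> \<longleftrightarrow> F x - l \<le> \<delta>" if "x \<in> S" for x
    using delta_pos by (simp add: \<psi>[OF that])
  have nle: "max 0 (\<psi> x) > ereal \<delta> \<longleftrightarrow> \<delta> < F x - l" if "x \<in> S" for x
    using le[OF that] by (meson not_le)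
  define i j where "i = nat \<lceil>log 2 M\<rceil>" and "j = nat \<lceil>log 2 (2 * M / (\<eta> * \<delta> ^ 3))\<rceil>"
  define c where "c = 22 * (1 + \<kappa> * K\<mu>) * (Wr * H)"
  have tol: "0 < \<eta> * \<delta> ^ 3" using eta_pos delta_pos by simp
  have "\<exists>z n. dual apgmu (\<lambda>y. g1 y + \<eta> / 2 * (norm (y - xf))\<^sup>2) g2 \<eta> (Lg + \<eta>) (\<lambda>y. f1 y - l) f2 Lf 1 M
      x_init \<delta> = Some ((X z, z), n) \<and>
    0 \<le> z \<and> z \<le> 2 * M \<and> max 0 (\<psi> (X z)) \<le> ereal \<delta> \<and>
    \<bar>ereal z * \<psi> (X z)\<bar> \<le> ereal (4 * M * \<delta>) \<and> real n \<le> real (2 + i + j) * c"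
  proof (rule dual_terminates[OF A \<psi>_def])
    show "max 0 (\<psi> (X z)) \<le> ereal \<delta>" if "M \<le> z" for z
      using oracle_feasible[OF that] oracle_spec(1)[of z] that M_bounds(1) le by auto
    show "\<eta> * \<delta> ^ 3 < b - a" if "0 \<le> a" "a < b" "b \<le> 2 * M" "max 0 (\<psi> (X a)) > ereal \<delta>"
      "max 0 (\<psi> (X b)) \<le> ereal \<delta>" "\<not> \<bar>ereal b * \<psi> (X b)\<bar> \<le> ereal (4 * M * \<delta>)" for a b
    proof -
      have S: "X a \<in> S" "X b \<in> S" using oracle_spec(1) that by auto
      show ?thesis using that unfolding le[OF S(2)] nle[OF S(1)] \<psi>[OF S(2)]
        by (intro oracle_gap) auto
    qed
    show "real (snd (A z)) \<le> c" if "0 \<le> z" "z \<le> 2 * M" for z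
      using oracle_cost[OF that] by (simp add: c_def)
    show "M \<le> 2 ^ i * 1" using le_two_power_nat_ceiling_log[of M] M_bounds(1) by (simp add: i_def)
    have "2 * M / (\<eta> * \<delta> ^ 3) \<le> 2 ^ j"
      unfolding j_def using M_bounds(1) tol by (intro le_two_power_nat_ceiling_log) auto
    then show "2 * M \<le> 2 ^ j * (\<eta> * \<delta> ^ 3)" using tol by (simp add: pos_divide_le_eq)
  qed (use M_bounds(1) delta_pos in auto)
  then obtain z n where zn: "dual apgmu (\<lambda>y. g1 y + \<eta> / 2 * (norm (y - xf))\<^sup>2) g2 \<eta> (Lg + \<eta>)
      (\<lambda>y. f1 y - l) f2 Lf 1 M x_init \<delta> = Some ((X z, z), n)" "0 \<le> z"
    "max 0 (\<psi> (X z)) \<le> ereal \<delta>" "\<bar>ereal z * \<psi> (X z)\<bar> \<le> ereal (4 * M * \<delta>)"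
    "real n \<le> real (2 + i + j) * c" by blast
  note X = oracle_spec(1)[OF zn(2)]
  have "ps \<le> l \<longrightarrow> G (X z) - G xg \<le> \<Delta>"
    using oracle_optimal[OF zn(2)] zn(4) \<psi>[OF X] by auto
  moreover have "real (2 + i + j) \<le> 14 * H"
    using number_of_calls_le[OF param_bounds] unfolding i_def j_def \<eta> \<delta> .
  then have "real (2 + i + j) * c \<le> 14 * H * c"
    using oracle_cost[of 0] M_bounds(1) of_nat_0_le_iff[of "snd (A 0)"] unfolding c_def
    by (intro mult_right_mono) linarith+
  then have "real n \<le> 308 * (1 + \<kappa> * K\<mu>) * (Wr * H\<^sup>2)"
    using zn(5) by (simp add: c_def power2_eq_square algebra_simps)
  moreover have "F (X z) \<le> l + \<delta>" using zn(3) le[OF X] by simp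
  ultimately show ?thesis using zn(1) X by blast
qed

text \<open>A segment from the nearly feasible \<open>x\<close> to the strictly feasible \<open>xf\<close> reaches the level
  \<open>l\<close> after a fraction of at most \<open>\<delta>/\<Delta>\<close>, over which \<open>g\<close> grows by at most \<open>M \<delta> \<le> \<Delta>/4\<close>.\<close>

lemma test_succeeds:
  assumes x: "x \<in> S" "F x \<le> l + \<delta>" and small: "4 * \<Delta> < ps - fs" "4 * \<Delta> < m"
  shows "\<Delta> < G x - G xg"
proof -
  define t where "t = \<delta> / (\<Delta> + \<delta>)"
  have t: "0 < t" "t < 1" "t * (\<Delta> + \<delta>) = \<delta>" using \<Delta> delta_pos by (auto simp: t_def)
  have tl: "t \<le> \<delta> / \<Delta>" unfolding t_def using \<Delta> delta_pos by (intro frac_le) auto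
  define y where "y = (1 - t) *\<^sub>R x + t *\<^sub>R xf"
  have y: "y \<in> S" unfolding y_def using x xf t S_convex by (auto intro: convexD)
  have "F y \<le> (1 - t) * F x + t * F xf"
    unfolding y_def using convex_onD[OF convex_F, of t x xf] t x xf by auto
  also have "\<dots> \<le> (1 - t) * (l + \<delta>) + t * (l - \<Delta>)"
    using t x l by (intro add_mono mult_left_mono) auto
  also have "\<dots> = l" using t(3) by (simp add: algebra_simps)
  finally have "F y \<le> (ps + fs) / 2" using l xf(2) small by simp
  then have "gs + m \<le> G y" by (rule m0_le[OF y])
  also have "\<dots> \<le> (1 - t) * G x + t * G xf"
    unfolding y_def using convex_onD[OF convex_G, of t x xf] t x xf by auto
  also have "\<dots> \<le> gs + (1 - t) * (G x - gs) + t * (M * \<Delta>)"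
    using mult_left_mono[OF M_bounds(3), of t] t by (simp add: algebra_simps)
  also have "\<dots> \<le> gs + (G x - gs) + \<delta> / \<Delta> * (M * \<Delta>)"
    using t tl g_star_le[OF x(1)] M_bounds(1) \<Delta>
    by (intro add_mono mult_right_mono) (auto simp: mult_left_le_one_le)
  also have "\<dots> = G x + M * \<delta>" using \<Delta> by simp
  also have "\<dots> \<le> G x + \<Delta> / 4"
    using M_delta eta_C_D mult_left_mono[of 1 "1 + D * (1 + D)" \<eta>] eta_pos D_pos by simp
  finally show ?thesis using small(2) xg(2) \<Delta> by linarith
qed

end

lemma lb_init_round_terminates:
  assumes \<Delta>: "\<Delta> = \<Delta>0 / 2" "0 < \<Delta>" "\<Delta> \<le> 1 / Bf" and S: "xf0 \<in> S" "xg0 \<in> S" "x0 \<in> S"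
  shows "\<exists>xf xg x M k. lb_init_round apg0 apgmu f1 f2 g1 g2 Lf Lg D \<Delta>0 xf0 xg0 x0
      = Some (F xf + \<Delta>, \<Delta>, xf, M, xg, x, k) \<and>
    xf \<in> S \<and> xg \<in> S \<and> x \<in> S \<and> G xg \<le> gs + \<Delta> \<and>
    M = max ((G xf - G xg + 1) / \<Delta>) 1 \<and> M * \<Delta> \<le> \<Omega> \<and>
    (ps \<le> F xf + \<Delta> \<longrightarrow> G x - G xg \<le> \<Delta>) \<and>
    (4 * \<Delta> < ps - fs \<and> 4 * \<Delta> < m \<longrightarrow> \<Delta> < G x - G xg) \<and>
    real k \<le> 320 * (1 + \<kappa> * (K0 + K\<mu>)) *
      (round_weight D \<Omega> Lf Lg \<Delta> * (log_factor D \<Omega> Lf Lg * (1 + ln (1 / \<Delta>)))\<^sup>2)"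
proof -
  obtain xf kf where xfk: "apg0 f1 (\<lambda>x. f2 x + indic S x) Lf \<Delta> xf0 D = (xf, kf)" by fastforce
  obtain xg kg where xgk: "apg0 g1 g2 Lg \<Delta> xg0 D = (xg, kg)" by fastforce
  note xf = apg0_f[OF \<Delta>(2) S(1) xfk] and xg = apg0_g[OF \<Delta>(2) S(2) xgk]
  define M where "M = max ((G xf - G xg + 1) / \<Delta>) 1"
  note ctx = \<Delta>(2,3) xf(1,2) xg(1,2) S(3) refl M_def refl refl refl
  obtain x z n where d: "dual apgmu (\<lambda>y. g1 y + \<Delta> / C_D D / 2 * (norm (y - xf))\<^sup>2) g2 (\<Delta> / C_D D)
      (Lg + \<Delta> / C_D D) (\<lambda>y. f1 y - (F xf + \<Delta>)) f2 Lf 1 M x0 (\<Delta> / (4 * C_D D * M)) = Some ((x, z), n)"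
    "x \<in> S" "F x \<le> F xf + \<Delta> + \<Delta> / (4 * C_D D * M)" "ps \<le> F xf + \<Delta> \<longrightarrow> G x - G xg \<le> \<Delta>"
    "real n \<le> 308 * (1 + \<kappa> * K\<mu>) * (round_weight D \<Omega> Lf Lg \<Delta> *
      (log_factor D \<Omega> Lf Lg * (1 + ln (1 / \<Delta>)))\<^sup>2)"
    using dual_round[OF ctx] by blast
  have eq: "lb_init_round apg0 apgmu f1 f2 g1 g2 Lf Lg D \<Delta>0 xf0 xg0 x0
      = Some (F xf + \<Delta>, \<Delta>, xf, M, xg, x, kf + kg + n + 8)"
    using d(1) unfolding lb_init_round_def \<Delta>(1)[symmetric] F_def[symmetric] G_def[symmetric]
    by (simp add: Let_def M_def xfk xgk)
  note param_bounds = param_bounds[OF ctx]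
  define W where "W = round_weight D \<Omega> Lf Lg \<Delta>"
  define H2 where "H2 = (log_factor D \<Omega> Lf Lg * (1 + ln (1 / \<Delta>)))\<^sup>2"
  have W: "1 \<le> W" using round_weight_ge_1[OF param_bounds] by (simp add: W_def)
  have H2: "1 \<le> H2" unfolding H2_def using H_ge_1[OF ctx] by (intro one_le_power)
  have "K0 * (1 + D * sqrt (Lf / \<Delta>)) + K0 * (1 + D * sqrt (Lg / \<Delta>)) = K0 * (2 + (D * sqrt (Lf / \<Delta>) + D * sqrt (Lg / \<Delta>)))"
    by (simp add: algebra_simps)
  also have "\<dots> \<le> K0 * (3 * W)"
  proof (rule mult_left_mono[OF _ K0])
    have "D * sqrt (Lf / \<Delta>) + D * sqrt (Lg / \<Delta>) \<le> W"
      unfolding W_def round_weight_def by (intro add_mono apg0_cost_le[OF param_bounds])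
    then show "2 + (D * sqrt (Lf / \<Delta>) + D * sqrt (Lg / \<Delta>)) \<le> 3 * W" using W by linarith
  qed
  finally have "\<kappa> * (K0 * (1 + D * sqrt (Lf / \<Delta>)) + K0 * (1 + D * sqrt (Lg / \<Delta>))) \<le> \<kappa> * (K0 * (3 * W))"
    by (intro mult_left_mono) auto
  then have "real (kf + kg) \<le> \<kappa> * (K0 * (3 * W))" using xf(3) xg(3) by (simp add: distrib_left)
  then have "real (kf + kg + n + 8) \<le> (8 + 3 * (\<kappa> * K0)) * W + 308 * (1 + \<kappa> * K\<mu>) * (W * H2)"
    using d(5) W unfolding W_def[symmetric] H2_def[symmetric] by (simp add: algebra_simps)
  also have "\<dots> \<le> (8 + 3 * (\<kappa> * K0)) * (W * H2) + 308 * (1 + \<kappa> * K\<mu>) * (W * H2)"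
    using W H2 K0 mult_left_mono[of 1 H2 W] by (intro add_right_mono mult_left_mono) auto
  also have "\<dots> = (316 + 3 * (\<kappa> * K0) + 308 * (\<kappa> * K\<mu>)) * (W * H2)" by (simp add: algebra_simps)
  also have "\<dots> \<le> (320 * (1 + \<kappa> * (K0 + K\<mu>))) * (W * H2)"
  proof (rule mult_right_mono)
    have "0 \<le> \<kappa> * K0" "0 \<le> \<kappa> * K\<mu>" using K0 K\<mu> by auto
    then show "316 + 3 * (\<kappa> * K0) + 308 * (\<kappa> * K\<mu>) \<le> 320 * (1 + \<kappa> * (K0 + K\<mu>))"
      unfolding distrib_left by linarith
  qed (use W H2 in auto)
  finally have cost: "real (kf + kg + n + 8) \<le> 320 * (1 + \<kappa> * (K0 + K\<mu>)) * (W * H2)" .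
  show ?thesis
    using eq xf(1) xg(1,2) d(2,4) M_def M_bounds(2)[OF ctx] cost test_succeeds[OF ctx d(2,3)]
    unfolding W_def H2_def by blast
qed

end


section \<open>The main loop\<close>

context bilevel_apg
begin

text \<open>The weights of the rounds from tolerance \<open>\<Delta>\<close> down to a tolerance of at least \<open>1/Q\<close> form
  geometric sums, which are dominated by their last terms. The subtracted terms
  make the bound inductive.\<close>

definition weight_budget :: "real \<Rightarrow> real \<Rightarrow> real" where
  "weight_budget Q \<Delta> = sqrt (C_D D * Lf * \<Omega>) * (2 * Q - 1 / \<Delta>)
     + sqrt (C_D D * Lg) * (7 / 2 * sqrt Q - 5 / 2 / sqrt \<Delta>)"

lemma sqrt_parts_nonneg: "0 \<le> sqrt (C_D D * Lf * \<Omega>)" "0 \<le> sqrt (C_D D * Lg)"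
  using Omega_ge_1 Lf_pos Lg_ge_1 D_pos by (auto simp: C_D_def)

lemma round_weight_le_budget:
  assumes "0 < \<Delta>" "1 / Q \<le> \<Delta>" "0 < Q"
  shows "round_weight D \<Omega> Lf Lg \<Delta> \<le> weight_budget Q \<Delta>"
proof -
  have Q: "1 / \<Delta> \<le> Q" using assms by (simp add: field_simps)
  then have "sqrt (1 / \<Delta>) \<le> sqrt Q" by (rule real_sqrt_le_mono)
  then have sQ: "1 / sqrt \<Delta> \<le> sqrt Q" by (simp add: real_sqrt_divide)
  have "sqrt (C_D D * Lf * \<Omega>) * (1 / \<Delta>) \<le> sqrt (C_D D * Lf * \<Omega>) * (2 * Q - 1 / \<Delta>)"
    using Q sqrt_parts_nonneg by (intro mult_left_mono) auto
  moreover have "5 / 2 / sqrt \<Delta> = 5 / 2 * (1 / sqrt \<Delta>)" by simp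
  then have "1 / sqrt \<Delta> \<le> 7 / 2 * sqrt Q - 5 / 2 / sqrt \<Delta>" using sQ by linarith
  then have "sqrt (C_D D * Lg) * (1 / sqrt \<Delta>) \<le> sqrt (C_D D * Lg) * (7 / 2 * sqrt Q - 5 / 2 / sqrt \<Delta>)"
    using sqrt_parts_nonneg by (intro mult_left_mono) auto
  ultimately show ?thesis unfolding round_weight_def weight_budget_def by simp
qed

lemma round_weight_add_budget_le:
  assumes "0 < \<Delta>"
  shows "round_weight D \<Omega> Lf Lg \<Delta> + weight_budget Q (\<Delta> / 2) \<le> weight_budget Q \<Delta>"
proof -
  define s where "s = 1 / sqrt \<Delta>"
  have s: "0 \<le> s" using assms by (simp add: s_def)
  have "(7 / 5)\<^sup>2 \<le> (2::real)" by (simp add: power2_eq_square)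
  then have "7 / 5 \<le> sqrt 2" by (rule real_le_rsqrt)
  then have "7 / 5 * s \<le> sqrt 2 * s" using s by (rule mult_right_mono)
  then have 1: "s + (7 / 2 * sqrt Q - 5 / 2 * (sqrt 2 * s)) \<le> 7 / 2 * sqrt Q - 5 / 2 * s" by simp
  have 2: "5 / 2 / sqrt (\<Delta> / 2) = 5 / 2 * (sqrt 2 * s)" "5 / 2 / sqrt \<Delta> = 5 / 2 * s"
    by (simp_all add: s_def real_sqrt_divide)
  have "round_weight D \<Omega> Lf Lg \<Delta> + weight_budget Q (\<Delta> / 2)
    = sqrt (C_D D * Lf * \<Omega>) * (2 * Q - 1 / \<Delta>)
      + sqrt (C_D D * Lg) * (s + (7 / 2 * sqrt Q - 5 / 2 * (sqrt 2 * s)))"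
    unfolding round_weight_def weight_budget_def 2 by (simp add: s_def algebra_simps)
  also have "\<dots> \<le> weight_budget Q \<Delta>"
    unfolding weight_budget_def 2 using 1 sqrt_parts_nonneg by (intro add_left_mono mult_left_mono) auto
  finally show ?thesis .
qed

text \<open>The tolerance never falls below \<open>1/Q\<close>: a round with tolerance below \<open>2/Q\<close> is the last one, by
  the choice of \<open>Q\<close>. The induction is on a number \<open>j\<close> of halvings that would bring the
  tolerance below \<open>1/Q\<close>.\<close>

lemma lb_init_loop_terminates:
  assumes Q: "8 / (ps - fs) \<le> Q" "8 / m \<le> Q" "0 < Q" and B: "B = 320 * (1 + \<kappa> * (K0 + K\<mu>)) *
      (log_factor D \<Omega> Lf Lg * (1 + ln Q))\<^sup>2"
    and "0 < \<Delta>0" "\<Delta>0 / 2 \<le> 1 / Bf" "1 / Q \<le> \<Delta>0 / 2" "\<Delta>0 / 2 < 2 ^ j / Q"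
    and "xf0 \<in> S" "xg0 \<in> S" "x0 \<in> S"
  shows "\<exists>l \<Delta> xf M T. lb_init_loop (lb_init_round apg0 apgmu f1 f2 g1 g2 Lf Lg D) (esum g1 g2) \<Delta>0
      xf0 xg0 x0 n = Some ((l, \<Delta>, xf, M), T) \<and>
    reference_certificate f1 f2 g1 g2 (l, \<Delta>, xf, M) \<and> M \<le> \<Omega> * Q \<and> 1 / Q \<le> \<Delta> \<and>
    real T \<le> real n + B * weight_budget Q (\<Delta>0 / 2)"
  using assms(5-)
proof (induction j arbitrary: \<Delta>0 xf0 xg0 x0 n)
  case 0
  then show ?case by simp
next
  case (Suc j)
  define \<Delta> where "\<Delta> = \<Delta>0 / 2"
  have \<Delta>: "0 < \<Delta>" "\<Delta> \<le> 1 / Bf" "1 / Q \<le> \<Delta>" "\<Delta> < 2 ^ Suc j / Q"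
    using Suc.prems by (auto simp: \<Delta>_def)
  have invD: "1 / \<Delta> \<le> Q" using \<Delta> Q by (simp add: field_simps)
  have "1 / Bf \<le> 1" using Bf by simp
  then have \<Delta>1: "\<Delta> \<le> 1" using \<Delta> by linarith
  obtain xf xg x M k where round: "lb_init_round apg0 apgmu f1 f2 g1 g2 Lf Lg D \<Delta>0 xf0 xg0 x0
      = Some (F xf + \<Delta>, \<Delta>, xf, M, xg, x, k)"
    and S: "xf \<in> S" "xg \<in> S" "x \<in> S" and Gxg: "G xg \<le> gs + \<Delta>"
    and M: "M = max ((G xf - G xg + 1) / \<Delta>) 1" "M * \<Delta> \<le> \<Omega>"
    and opt: "ps \<le> F xf + \<Delta> \<Longrightarrow> G x - G xg \<le> \<Delta>"
    and test: "4 * \<Delta> < ps - fs \<Longrightarrow> 4 * \<Delta> < m \<Longrightarrow> \<Delta> < G x - G xg"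
    and k: "real k \<le> 320 * (1 + \<kappa> * (K0 + K\<mu>)) *
      (round_weight D \<Omega> Lf Lg \<Delta> * (log_factor D \<Omega> Lf Lg * (1 + ln (1 / \<Delta>)))\<^sup>2)"
    using lb_init_round_terminates[OF \<Delta>_def \<Delta>(1,2) Suc.prems(5-7)] by blast
  have P: "0 \<le> 1 + \<kappa> * (K0 + K\<mu>)" using K0 K\<mu> by auto
  have B0: "0 \<le> B" using P by (simp add: B)
  have w: "0 \<le> round_weight D \<Omega> Lf Lg \<Delta>"
    using sqrt_parts_nonneg \<Delta> by (simp add: round_weight_def)
  have "log_factor D \<Omega> Lf Lg * (1 + ln (1 / \<Delta>)) \<le> log_factor D \<Omega> Lf Lg * (1 + ln Q)"
    using invD \<Delta> Q Omega_ge_1 Lf_pos Lg_ge_1 D_pos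
    by (intro mult_left_mono) (auto simp: log_factor_def simp del: ln_inverse simp: ln_div[symmetric])
  moreover have "0 \<le> log_factor D \<Omega> Lf Lg * (1 + ln (1 / \<Delta>))"
    using \<Delta> \<Delta>1 Omega_ge_1 Lf_pos Lg_ge_1 D_pos
    by (intro mult_nonneg_nonneg add_nonneg_nonneg) (auto simp: log_factor_def)
  ultimately have "(log_factor D \<Omega> Lf Lg * (1 + ln (1 / \<Delta>)))\<^sup>2 \<le> (log_factor D \<Omega> Lf Lg * (1 + ln Q))\<^sup>2"
    by (intro power_mono)
  then have "round_weight D \<Omega> Lf Lg \<Delta> * (log_factor D \<Omega> Lf Lg * (1 + ln (1 / \<Delta>)))\<^sup>2
      \<le> round_weight D \<Omega> Lf Lg \<Delta> * (log_factor D \<Omega> Lf Lg * (1 + ln Q))\<^sup>2"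
    using w by (rule mult_left_mono)
  then have "320 * (1 + \<kappa> * (K0 + K\<mu>)) *
      (round_weight D \<Omega> Lf Lg \<Delta> * (log_factor D \<Omega> Lf Lg * (1 + ln (1 / \<Delta>)))\<^sup>2)
      \<le> 320 * (1 + \<kappa> * (K0 + K\<mu>)) *
      (round_weight D \<Omega> Lf Lg \<Delta> * (log_factor D \<Omega> Lf Lg * (1 + ln Q))\<^sup>2)"
    by (rule mult_left_mono) (use P in simp)
  then have kB: "real k \<le> B * round_weight D \<Omega> Lf Lg \<Delta>" using k by (simp add: B ac_simps)
  have eq: "lb_init_loop (lb_init_round apg0 apgmu f1 f2 g1 g2 Lf Lg D) (esum g1 g2) \<Delta>0 xf0 xg0 x0 n =
    (if G x - G xg > \<Delta> then Some ((F xf + \<Delta>, \<Delta>, xf, M), n + k)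
     else lb_init_loop (lb_init_round apg0 apgmu f1 f2 g1 g2 Lf Lg D) (esum g1 g2) \<Delta> xf xg x (n + k))"
    by (subst lb_init_loop.simps) (simp add: round esum_g S)
  show ?case
  proof (cases "G x - G xg > \<Delta>")
    case True
    have "F xf + \<Delta> < ps" using True opt by fastforce
    moreover have "fs < F xf + \<Delta>" using f_star_le[OF S(1)] \<Delta> by simp
    moreover have "G xg - gs \<le> 1" using Gxg \<Delta>1 by simp
    ultimately have "reference_certificate f1 f2 g1 g2 (F xf + \<Delta>, \<Delta>, xf, M)"
      unfolding reference_certificate_def G_def[symmetric] using S \<Delta> M(1) by (auto simp: esum_f)
    moreover have "M \<le> \<Omega> * Q"
    proof -
      have "M \<le> \<Omega> * (1 / \<Delta>)" using M(2) \<Delta> by (simp add: field_simps)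
      also have "\<dots> \<le> \<Omega> * Q" using invD Omega_ge_1 by (intro mult_left_mono) auto
      finally show ?thesis .
    qed
    moreover have "real (n + k) \<le> real n + B * weight_budget Q \<Delta>"
      using kB mult_left_mono[OF round_weight_le_budget[OF \<Delta>(1,3) Q(3)] B0] by simp
    ultimately show ?thesis unfolding eq using True \<Delta>(3) by (simp add: \<Delta>_def[symmetric])
  next
    case False
    have "2 / Q \<le> \<Delta>"
    proof (rule ccontr)
      assume "\<not> 2 / Q \<le> \<Delta>"
      then have d: "4 * \<Delta> < 8 / Q" using Q by (simp add: field_simps)
      have "8 / Q \<le> ps - fs" "8 / Q \<le> m"
        using Q fs_less_ps m0_pos by (simp_all add: field_simps)
      then show False using test d False by simp
    qed
    then have "1 / Q \<le> \<Delta> / 2" "\<Delta> / 2 < 2 ^ j / Q" using \<Delta> by (auto simp: ac_simps)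
    then have "\<exists>l \<Delta>' xf' M T. lb_init_loop (lb_init_round apg0 apgmu f1 f2 g1 g2 Lf Lg D) (esum g1 g2) \<Delta>
        xf xg x (n + k) = Some ((l, \<Delta>', xf', M), T) \<and>
      reference_certificate f1 f2 g1 g2 (l, \<Delta>', xf', M) \<and> M \<le> \<Omega> * Q \<and> 1 / Q \<le> \<Delta>' \<and>
      real T \<le> real (n + k) + B * weight_budget Q (\<Delta> / 2)"
      using \<Delta> S by (intro Suc.IH) auto
    moreover have "real (n + k) + B * weight_budget Q (\<Delta> / 2) \<le> real n + B * weight_budget Q \<Delta>"
      using kB mult_left_mono[OF round_weight_add_budget_le[OF \<Delta>(1), of Q] B0] by (simp add: distrib_left)
    ultimately show ?thesis unfolding eq using False by (fastforce simp: \<Delta>_def[symmetric])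
  qed
qed

lemma lb_init_terminates:
  assumes Q: "Q = Q_init f1 f2 g1 g2 d_init" and d: "0 < d_init" "d_init \<le> 1 / Bf"
    and init: "xf_init \<in> S" "xg_init \<in> S"
  shows "\<exists>l0 \<Delta> xf M T.
    lb_init apg0 apgmu f1 f2 g1 g2 Lf Lg d_init D Bf xf_init xg_init = Some ((l0, \<Delta>, xf, M), T) \<and>
    reference_certificate f1 f2 g1 g2 (l0, \<Delta>, xf, M) \<and> M \<le> \<Omega> * Q \<and> \<Delta> \<ge> 1 / Q \<and>
    real T \<le> hidden_const K0 K\<mu> \<kappa> D \<Omega> Lf Lg *
      ((sqrt (C_D D * Lf * \<Omega>) * Q + sqrt (C_D D * Lg) * sqrt Q) * (1 + ln Q)\<^sup>2)"
proof -
  have Q': "1 / d_init \<le> Q" "8 / (ps - fs) \<le> Q" "8 / m \<le> Q" by (simp_all add: Q Q_init_def)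
  have "0 < 1 / d_init" using d by simp
  then have Q0: "0 < Q" using Q' by linarith
  have Qd: "1 / Q \<le> d_init" using Q'(1) Q0 d by (simp add: field_simps)
  obtain j where "Q * d_init < 2 ^ j" using real_arch_pow[of 2 "Q * d_init"] by auto
  then have j: "d_init < 2 ^ j / Q" using Q0 by (simp add: field_simps)
  define P where "P = 1 + \<kappa> * (K0 + K\<mu>)"
  define Lm where "Lm = log_factor D \<Omega> Lf Lg"
  define p q where "p = sqrt (C_D D * Lf * \<Omega>)" and "q = sqrt (C_D D * Lg)"
  have pq: "0 \<le> p" "0 \<le> q" using sqrt_parts_nonneg by (simp_all add: p_def q_def)
  define B where "B = 320 * P * (Lm * (1 + ln Q))\<^sup>2"
  have P: "0 \<le> P" using K0 K\<mu> by (simp add: P_def)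
  then have B: "0 \<le> B" by (simp add: B_def)
  obtain l \<Delta> xf M T where run: "lb_init_loop (lb_init_round apg0 apgmu f1 f2 g1 g2 Lf Lg D)
      (esum g1 g2) (2 * d_init) xf_init xg_init xf_init 0 = Some ((l, \<Delta>, xf, M), T)"
    "reference_certificate f1 f2 g1 g2 (l, \<Delta>, xf, M)" "M \<le> \<Omega> * Q" "1 / Q \<le> \<Delta>"
    "real T \<le> B * weight_budget Q d_init"
    using lb_init_loop_terminates[OF Q'(2,3) Q0, of B "2 * d_init" j xf_init xg_init xf_init 0]
      d init Qd j unfolding B_def P_def Lm_def by auto
  have "weight_budget Q d_init \<le> p * (2 * Q) + q * (7 / 2 * sqrt Q)"
    unfolding weight_budget_def p_def[symmetric] q_def[symmetric]
    using pq d by (intro add_mono mult_left_mono) auto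
  also have "\<dots> \<le> 4 * (p * Q + q * sqrt Q)"
    using mult_nonneg_nonneg[OF pq(1), of Q] mult_nonneg_nonneg[OF pq(2), of "sqrt Q"] Q0
    by (simp add: algebra_simps)
  finally have "real T \<le> B * (4 * (p * Q + q * sqrt Q))"
    using run(5) mult_left_mono[OF _ B] by fastforce
  also have "\<dots> = 1280 * (P * Lm\<^sup>2 * ((p * Q + q * sqrt Q) * (1 + ln Q)\<^sup>2))"
    by (simp add: B_def power_mult_distrib)
  also have "\<dots> \<le> 10 ^ 6 * (P * Lm\<^sup>2 * ((p * Q + q * sqrt Q) * (1 + ln Q)\<^sup>2))"
    using P pq Q0 by (intro mult_right_mono mult_nonneg_nonneg add_nonneg_nonneg) auto
  also have "\<dots> = hidden_const K0 K\<mu> \<kappa> D \<Omega> Lf Lg * ((p * Q + q * sqrt Q) * (1 + ln Q)\<^sup>2)"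
    unfolding hidden_const_def P_def Lm_def log_factor_def by (simp only: mult.assoc)
  finally show ?thesis using run(1-4) unfolding lb_init_def p_def q_def by blast
qed

end


theorem theorem6p1:
  fixes f1 g1 :: "real ^ 'n \<Rightarrow> real" and f2 g2 :: "real ^ 'n \<Rightarrow> ereal"
    and apg0 :: "(real ^ 'n) apg0" and apgmu :: "(real ^ 'n) apgmu"
    and Lf Lg D Bf d_init K0 K\<mu> \<Omega> Q :: real and \<kappa> :: nat
    and xf_init xg_init :: "real ^ 'n"
  assumes "\<Omega> = Omega_g g1 g2" and "Q = Q_init f1 f2 g1 g2 d_init"
    and "sbo_problem f1 f2 g1 g2 Lf Lg"
    and "assumption_A f1 f2 g1 g2"
    and "K0 \<ge> 0" and "apg0_spec K0 \<kappa> f1 f2 g1 g2 apg0"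
    and "K\<mu> \<ge> 0" and "apgmu_spec K\<mu> \<kappa> f1 f2 g1 g2 apgmu"
    and "D > 0" and "diameter (edom g2) \<le> D"
    and "Bf \<ge> 1" and "Bf-lipschitz_on (edom g2) (\<lambda>x. real_of_ereal (esum f1 f2 x))"
    and "0 < d_init" and "d_init \<le> 1 / Bf"
    and "xf_init \<in> edom g2" and "xg_init \<in> edom g2"
  shows "\<exists>l0 \<Delta> xf M T.
    lb_init apg0 apgmu f1 f2 g1 g2 Lf Lg d_init D Bf xf_init xg_init = Some ((l0, \<Delta>, xf, M), T) \<and>
    reference_certificate f1 f2 g1 g2 (l0, \<Delta>, xf, M) \<and>
    M \<le> \<Omega> * Q \<and> \<Delta> \<ge> 1 / Q \<and>
    real T \<le> hidden_const K0 K\<mu> \<kappa> D \<Omega> Lf Lg *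
      ((sqrt (C_D D * Lf * \<Omega>) * Q + sqrt (C_D D * Lg) * sqrt Q) * (1 + ln Q)\<^sup>2)"
proof -
  interpret bilevel_apg f1 g1 f2 g2 Lf Lg D apg0 apgmu K0 K\<mu> Bf \<kappa>
    by unfold_locales (rule assms)+
  show ?thesis
    unfolding assms(1) by (rule lb_init_terminates[OF assms(2,13-16)])
qed

end
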